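(* Let $E$ and $F$ be separable Gurariĭ spaces and let $\varepsilon>0$. Assume that $X\subseteq E$ is a finite dimensional linear subspace and that $f\colon X\to F$ is an $\varepsilon$-isometry. Then there exists a bijective isometry $h\colon E\to F$ such that $\|h\restriction X - f\|<\varepsilon$.
   Context: All Banach spaces are over one fixed scalar field (real or complex), the same for all spaces. $\|\cdot\|$ applied to linear operators is the operator norm. Subspaces of a Banach space carry the inherited norm, and $h\restriction X$ denotes the restriction of $h$ to $X$. $\varepsilon$-isometry: for Banach spaces $X,Y$ and $\varepsilon>0$, a linear operator $f\colon X\to Y$ is an $\varepsilon$-isometry if for every $x\in X$ with $\|x\|=1$ one has $(1+\varepsilon)^{-1}<\|f(x)\|<1+\varepsilon$ (strict inequalities). Isometry: a linear operator $f\colon X\to Y$ that is an $\varepsilon$-isometry for every $\varepsilon>0$, i.e. $\|f(x)\|=\|x\|$ for every $x\in X$; it is not assumed to be surjective. Gurariĭ space: a separable Banach space $\mathbb{G}$ such that, given finite dimensional Banach spaces $X\subseteq Y$ ($X$ a linear subspace of $Y$ with the inherited norm), given $\varepsilon>0$, and given an isometry (isometric linear embedding) $f\colon X\to\mathbb{G}$, there exists an injective linear operator $g\colon Y\to\mathbb{G}$ extending $f$ and satisfying $\|g\|\cdot\|g^{-1}\|<1+\varepsilon$, where $g^{-1}$ is the inverse of $g$ defined on $g[Y]$. *)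

theory Defs
  imports "HOL-Analysis.Analysis" "HOL-Library.Function_Algebras"
begin

text \<open>The scalar field is a normed real algebra isometrically isomorphic to the reals or to the
  complex numbers.\<close>

class real_or_complex = real_normed_field +
  assumes ex_embedding_complex:
    "\<exists>\<phi> :: 'a \<Rightarrow> complex.
       (\<forall>x y. \<phi> (x + y) = \<phi> x + \<phi> y) \<and> (\<forall>x y. \<phi> (x * y) = \<phi> x * \<phi> y) \<and>
       (\<forall>r x. \<phi> (r *\<^sub>R x) = r *\<^sub>R \<phi> x) \<and> (\<forall>x. norm (\<phi> x) = norm x) \<and>
       (range \<phi> = \<real> \<or> range \<phi> = UNIV)"

instance real :: real_or_complex
proof
  show "\<exists>\<phi> :: real \<Rightarrow> complex.
       (\<forall>x y. \<phi> (x + y) = \<phi> x + \<phi> y) \<and> (\<forall>x y. \<phi> (x * y) = \<phi> x * \<phi> y) \<and>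
       (\<forall>r x. \<phi> (r *\<^sub>R x) = r *\<^sub>R \<phi> x) \<and> (\<forall>x. norm (\<phi> x) = norm x) \<and>
       (range \<phi> = \<real> \<or> range \<phi> = UNIV)"
    by (rule exI[of _ complex_of_real]) (auto simp: Reals_def scaleR_conv_of_real)
qed

instance complex :: real_or_complex
proof
  show "\<exists>\<phi> :: complex \<Rightarrow> complex.
       (\<forall>x y. \<phi> (x + y) = \<phi> x + \<phi> y) \<and> (\<forall>x y. \<phi> (x * y) = \<phi> x * \<phi> y) \<and>
       (\<forall>r x. \<phi> (r *\<^sub>R x) = r *\<^sub>R \<phi> x) \<and> (\<forall>x. norm (\<phi> x) = norm x) \<and>
       (range \<phi> = \<real> \<or> range \<phi> = UNIV)"
    by (rule exI[of _ "\<lambda>x. x"]) auto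
qed

text \<open>The class \<open>banach\<close> of the library only provides real scalars; a Banach space over the scalar
  field is a real Banach space whose real scalar multiplication is extended by \<open>scale\<close>. Over the
  reals \<open>scale\<close> is forced to be \<open>scaleR\<close>.\<close>

locale banach_over = vector_space scale
  for scale :: "'k::real_or_complex \<Rightarrow> 'a::banach \<Rightarrow> 'a" +
  assumes scale_of_real: "scale (of_real r) x = r *\<^sub>R x"
    and norm_scale: "norm (scale c x) = norm c * norm x"

lemma banach_over_scaleR: "banach_over (scaleR :: real \<Rightarrow> 'a::banach \<Rightarrow> 'a)"
  by unfold_locales (auto simp: algebra_simps)

text \<open>Finite dimensional normed spaces are linear subspaces of some vector space, equipped with an
  explicit norm function that is only relevant on the subspace.\<close>

definition norm_on :: "('k::real_or_complex \<Rightarrow> 'v::ab_group_add \<Rightarrow> 'v) \<Rightarrow> 'v set \<Rightarrow> ('v \<Rightarrow> real) \<Rightarrow> bool"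
  where "norm_on s V N \<longleftrightarrow>
    (\<forall>x\<in>V. 0 \<le> N x) \<and> (\<forall>x\<in>V. N x = 0 \<longleftrightarrow> x = 0) \<and>
    (\<forall>x\<in>V. \<forall>y\<in>V. N (x + y) \<le> N x + N y) \<and> (\<forall>c. \<forall>x\<in>V. N (s c x) = norm c * N x)"

definition fin_dim_subspace :: "('k::real_or_complex \<Rightarrow> 'v::ab_group_add \<Rightarrow> 'v) \<Rightarrow> 'v set \<Rightarrow> bool"
  where "fin_dim_subspace s V \<longleftrightarrow>
    module.subspace s V \<and> (\<exists>B. finite B \<and> module.span s B = V)"

definition linear_op_on ::
    "('k::real_or_complex \<Rightarrow> 'v::ab_group_add \<Rightarrow> 'v) \<Rightarrow> ('k \<Rightarrow> 'w::ab_group_add \<Rightarrow> 'w) \<Rightarrow>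
     'v set \<Rightarrow> ('v \<Rightarrow> 'w) \<Rightarrow> bool"
  where "linear_op_on s t V f \<longleftrightarrow>
    (\<forall>x\<in>V. \<forall>y\<in>V. f (x + y) = f x + f y) \<and> (\<forall>c. \<forall>x\<in>V. f (s c x) = t c (f x))"

text \<open>The operator norm of \<open>f\<close> from \<open>(V, N)\<close> to a space normed by \<open>M\<close>: the relativisation of
  \<open>onorm\<close>. As there, the quotient at \<open>0\<close> is \<open>0\<close>, and the value is only meaningful for bounded
  operators, hence always when \<open>V\<close> is finite dimensional.\<close>

definition op_norm :: "'v set \<Rightarrow> ('v \<Rightarrow> real) \<Rightarrow> ('w \<Rightarrow> real) \<Rightarrow> ('v \<Rightarrow> 'w) \<Rightarrow> real"
  where "op_norm V N M f = (SUP x\<in>V. M (f x) / N x)"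

lemma op_norm_UNIV: "op_norm UNIV norm norm f = onorm f"
  by (simp add: op_norm_def onorm_def)

definition eps_isometry ::
    "('k::real_or_complex \<Rightarrow> 'v::ab_group_add \<Rightarrow> 'v) \<Rightarrow> ('k \<Rightarrow> 'w::ab_group_add \<Rightarrow> 'w) \<Rightarrow>
     'v set \<Rightarrow> ('v \<Rightarrow> real) \<Rightarrow> ('w \<Rightarrow> real) \<Rightarrow> real \<Rightarrow> ('v \<Rightarrow> 'w) \<Rightarrow> bool"
  where "eps_isometry s t V N M \<epsilon> f \<longleftrightarrow>
    linear_op_on s t V f \<and>
    (\<forall>x\<in>V. N x = 1 \<longrightarrow> inverse (1 + \<epsilon>) < M (f x) \<and> M (f x) < 1 + \<epsilon>)"

definition isometry_op ::
    "('k::real_or_complex \<Rightarrow> 'v::ab_group_add \<Rightarrow> 'v) \<Rightarrow> ('k \<Rightarrow> 'w::ab_group_add \<Rightarrow> 'w) \<Rightarrow>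
     'v set \<Rightarrow> ('v \<Rightarrow> real) \<Rightarrow> ('w \<Rightarrow> real) \<Rightarrow> ('v \<Rightarrow> 'w) \<Rightarrow> bool"
  where "isometry_op s t V N M f \<longleftrightarrow> linear_op_on s t V f \<and> (\<forall>x\<in>V. M (f x) = N x)"

text \<open>The extension property of \<open>G\<close> for all finite dimensional normed spaces \<open>X \<subseteq> Y\<close> that live in the
  vector space given by the scalar multiplication \<open>s\<close>; \<open>Y\<close> carries an arbitrary norm.\<close>

definition gurarii_extension ::
    "('k::real_or_complex \<Rightarrow> 'v::ab_group_add \<Rightarrow> 'v) \<Rightarrow> ('k \<Rightarrow> 'g::banach \<Rightarrow> 'g) \<Rightarrow> bool"
  where "gurarii_extension s t \<longleftrightarrow>
    (\<forall>Y N X \<epsilon> f.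
       fin_dim_subspace s Y \<and> norm_on s Y N \<and> module.subspace s X \<and> X \<subseteq> Y \<and> 0 < \<epsilon> \<and>
       isometry_op s t X N norm f \<longrightarrow>
       (\<exists>g. linear_op_on s t Y g \<and> inj_on g Y \<and> (\<forall>x\<in>X. g x = f x) \<and>
            op_norm Y N norm g * op_norm (g ` Y) norm N (the_inv_into Y g) < 1 + \<epsilon>))"

definition pointwise_scale :: "'k::real_or_complex \<Rightarrow> (nat \<Rightarrow> 'k) \<Rightarrow> nat \<Rightarrow> 'k"
  where "pointwise_scale c v = (\<lambda>i. c * v i)"

text \<open>HOL cannot quantify over all types inside a definition, so the finite dimensional spaces of the
  extension property are taken among the subspaces of the space of all scalar sequences, with an
  arbitrary norm. Up to isometric isomorphism these are all finite dimensional normed spaces; lemma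
  \<open>gurarii_space_extension\<close> below shows that nothing is lost.\<close>

definition gurarii_space :: "('k::real_or_complex \<Rightarrow> 'g::banach \<Rightarrow> 'g) \<Rightarrow> bool"
  where "gurarii_space t \<longleftrightarrow>
    banach_over t \<and> separable_space (euclidean :: 'g topology) \<and>
    gurarii_extension pointwise_scale t"

lemma norm_on_norm:
  assumes "banach_over s"
  shows "norm_on s V norm"
  using banach_over.norm_scale[OF assms] by (auto simp: norm_on_def norm_triangle_ineq)

lemma isometry_op_iff_eps_isometry:
  assumes "vector_space s" "banach_over t" "module.subspace s V" "norm_on s V N"
  shows "isometry_op s t V N norm f \<longleftrightarrow> (\<forall>\<epsilon>>0. eps_isometry s t V N norm \<epsilon> f)"
proof
  interpret s: vector_space s by fact
  interpret t: banach_over t by fact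
  show "isometry_op s t V N norm f \<Longrightarrow> \<forall>\<epsilon>>0. eps_isometry s t V N norm \<epsilon> f"
    by (auto simp: isometry_op_def eps_isometry_def inverse_eq_divide)
  assume *: "\<forall>\<epsilon>>0. eps_isometry s t V N norm \<epsilon> f"
  have lin: "linear_op_on s t V f"
    using *[rule_format, of 1] by (simp add: eps_isometry_def)
  have one: "norm (f x) = 1" if x: "x \<in> V" "N x = 1" for x
  proof (rule antisym)
    have b: "inverse (1 + \<epsilon>) < norm (f x)" "norm (f x) < 1 + \<epsilon>" if "\<epsilon> > 0" for \<epsilon>
      using *[rule_format, OF that] x by (simp_all add: eps_isometry_def)
    show "norm (f x) \<le> 1"
      by (rule field_le_epsilon) (rule less_imp_le[OF b(2)])
    show "1 \<le> norm (f x)"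
    proof (rule ccontr)
      assume "\<not> 1 \<le> norm (f x)"
      moreover have "0 < norm (f x)" using b(1)[of 1] by auto
      ultimately have "0 < inverse (norm (f x)) - 1" by (simp add: one_less_inverse)
      from b(1)[OF this] show False by simp
    qed
  qed
  have "norm (f x) = N x" if x: "x \<in> V" for x
  proof (cases "x = 0")
    case True
    have "f (s 0 x) = t 0 (f x)" using lin x by (simp only: linear_op_on_def)
    then show ?thesis using True assms(4) x by (auto simp: norm_on_def)
  next
    case False
    then have pos: "N x > 0" using assms(4) x by (auto simp: norm_on_def less_le)
    let ?c = "of_real (inverse (N x))"
    have "N (s ?c x) = 1" using assms(4) x pos by (auto simp: norm_on_def norm_inverse)
    moreover have "s ?c x \<in> V" using s.subspace_scale[OF assms(3) x] .
    ultimately have "norm (f (s ?c x)) = 1" by (rule one[rotated])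
    moreover have "f (s ?c x) = t ?c (f x)" using lin x by (simp only: linear_op_on_def)
    ultimately have "norm (t ?c (f x)) = 1" by (simp only:)
    then have "inverse (N x) * norm (f x) = 1" using pos by (simp add: t.norm_scale norm_inverse)
    then show ?thesis using pos by (simp add: field_simps)
  qed
  with lin show "isometry_op s t V N norm f" by (simp add: isometry_op_def)
qed

lemma vector_space_pointwise_scale: "vector_space (pointwise_scale :: 'k::real_or_complex \<Rightarrow> _)"
  by unfold_locales (auto simp: pointwise_scale_def fun_eq_iff algebra_simps)

lemma ex_linear_embedding_sequences:
  fixes s :: "'k::real_or_complex \<Rightarrow> 'v::ab_group_add \<Rightarrow> 'v"
  assumes "vector_space s" "fin_dim_subspace s Y"
  obtains \<phi> where "Vector_Spaces.linear s pointwise_scale \<phi>" "inj_on \<phi> Y"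
proof -
  interpret s: vector_space s by fact
  interpret p: vector_space "pointwise_scale :: 'k \<Rightarrow> _" by (rule vector_space_pointwise_scale)
  interpret sp: vector_space_pair s "pointwise_scale :: 'k \<Rightarrow> _" ..
  obtain A where A: "finite A" "s.span A = Y" using assms(2) by (auto simp: fin_dim_subspace_def)
  obtain B where B: "B \<subseteq> A" "s.independent B" "A \<subseteq> s.span B"
    by (rule s.maximal_independent_subset)
  have fB: "finite B" using A(1) B(1) by (rule rev_finite_subset)
  have Y: "Y = s.span B" using A B s.span_eq s.span_mono s.span_span by (metis subset_antisym)
  obtain e :: "'v \<Rightarrow> nat" where e: "inj_on e B"
    using finite_imp_inj_to_nat_seg[OF fB] by auto
  define d :: "'v \<Rightarrow> nat \<Rightarrow> 'k" where "d = (\<lambda>b i. if i = e b then 1 else 0)"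
  obtain \<phi> where lin: "Vector_Spaces.linear s pointwise_scale \<phi>" and \<phi>: "\<forall>b\<in>B. \<phi> b = d b"
    using sp.linear_independent_extend[OF B(2), of d] by auto
  interpret l: Vector_Spaces.linear s pointwise_scale \<phi> by fact
  have sumfun: "(\<Sum>b\<in>S. h b) i = (\<Sum>b\<in>S. h b i)" for h :: "'v \<Rightarrow> nat \<Rightarrow> 'k" and S i
    by (induction S rule: infinite_finite_induct) auto
  have "inj_on \<phi> (s.span B)"
    unfolding l.inj_on_iff_eq_0[OF s.subspace_span]
  proof (intro ballI impI)
    fix y assume "y \<in> s.span B" and 0: "\<phi> y = 0"
    then obtain u where y: "y = (\<Sum>b\<in>B. s (u b) b)"
      using s.span_finite[OF fB] by auto
    have "u b = 0" if b: "b \<in> B" for b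
    proof -
      have "\<phi> y = (\<Sum>b\<in>B. pointwise_scale (u b) (d b))"
        by (simp add: y l.sum l.scale \<phi>)
      then have "\<phi> y (e b) = (\<Sum>a\<in>B. u a * (if e b = e a then 1 else 0))"
        by (simp add: sumfun pointwise_scale_def d_def)
      also have "\<dots> = (\<Sum>a\<in>B. if a = b then u a else 0)"
        using e b by (intro sum.cong) (auto simp: inj_on_def)
      also have "\<dots> = u b" using b fB by simp
      finally show ?thesis using 0 by simp
    qed
    then show "y = 0" by (simp add: y)
  qed
  with lin Y that show ?thesis by blast
qed

lemma gurarii_space_extension:
  fixes s :: "'k::real_or_complex \<Rightarrow> 'v::ab_group_add \<Rightarrow> 'v"
  assumes "gurarii_space t" "vector_space s"
  shows "gurarii_extension s t"
  unfolding gurarii_extension_def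
proof (intro allI impI, elim conjE)
  fix Y N X and \<epsilon> :: real and f
  assume Y: "fin_dim_subspace s Y" and N: "norm_on s Y N" and X: "module.subspace s X" "X \<subseteq> Y"
    and \<epsilon>: "0 < \<epsilon>" and f: "isometry_op s t X N norm f"
  interpret s: vector_space s by fact
  interpret p: vector_space "pointwise_scale :: 'k \<Rightarrow> _" by (rule vector_space_pointwise_scale)
  obtain \<phi> where lin: "Vector_Spaces.linear s pointwise_scale \<phi>" and inj: "inj_on \<phi> Y"
    using ex_linear_embedding_sequences[OF assms(2) Y] .
  interpret l: Vector_Spaces.linear s pointwise_scale \<phi> by fact
  have sY: "s.subspace Y" using Y by (simp add: fin_dim_subspace_def)
  define \<psi> where "\<psi> = the_inv_into Y \<phi>"
  have \<psi>: "\<psi> (\<phi> y) = y" if "y \<in> Y" for y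
    using inj that by (simp add: \<psi>_def the_inv_into_f_f)
  have Y': "fin_dim_subspace pointwise_scale (\<phi> ` Y)"
    using Y l.span_image unfolding fin_dim_subspace_def
    by (metis finite_imageI p.subspace_span)
  have add: "\<psi> (\<phi> x + \<phi> y) = x + y" if "x \<in> Y" "y \<in> Y" for x y
    using \<psi>[of "x + y"] that s.subspace_add[OF sY] by (simp add: l.add)
  have scale: "\<psi> (pointwise_scale c (\<phi> x)) = s c x" if "x \<in> Y" for c x
    using \<psi>[of "s c x"] that s.subspace_scale[OF sY] by (simp add: l.scale)
  have zero: "\<phi> x = 0 \<longleftrightarrow> x = 0" if "x \<in> Y" for x
    using l.inj_on_iff_eq_0[OF sY] inj that by auto
  have N': "norm_on pointwise_scale (\<phi> ` Y) (N \<circ> \<psi>)"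
    using N by (auto simp: norm_on_def \<psi> add scale zero)
  have f': "isometry_op pointwise_scale t (\<phi> ` X) (N \<circ> \<psi>) norm (f \<circ> \<psi>)"
    using f X by (auto simp: isometry_op_def linear_op_on_def \<psi> add scale subset_iff)
  have X': "p.subspace (\<phi> ` X)" "\<phi> ` X \<subseteq> \<phi> ` Y"
    using X l.subspace_image by auto
  have ext: "gurarii_extension pointwise_scale t"
    using assms(1) by (simp add: gurarii_space_def)
  have "\<exists>g. linear_op_on pointwise_scale t (\<phi> ` Y) g \<and> inj_on g (\<phi> ` Y) \<and>
      (\<forall>x\<in>\<phi> ` X. g x = (f \<circ> \<psi>) x) \<and>
      op_norm (\<phi> ` Y) (N \<circ> \<psi>) norm g *
      op_norm (g ` \<phi> ` Y) norm (N \<circ> \<psi>) (the_inv_into (\<phi> ` Y) g) < 1 + \<epsilon>"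
    by (rule ext[unfolded gurarii_extension_def, THEN spec, THEN spec, THEN spec, THEN spec,
          THEN spec, THEN mp]) (intro conjI Y' N' X' \<epsilon> f')
  then obtain g where g: "linear_op_on pointwise_scale t (\<phi> ` Y) g"
      "inj_on g (\<phi> ` Y)" "\<forall>x\<in>\<phi> ` X. g x = (f \<circ> \<psi>) x"
      "op_norm (\<phi> ` Y) (N \<circ> \<psi>) norm g *
       op_norm (g ` \<phi> ` Y) norm (N \<circ> \<psi>) (the_inv_into (\<phi> ` Y) g) < 1 + \<epsilon>"
    by (elim exE conjE)
  have inj': "inj_on (g \<circ> \<phi>) Y" using inj g(2) by (rule comp_inj_on)
  have "op_norm (\<phi> ` Y) (N \<circ> \<psi>) norm g = op_norm Y N norm (g \<circ> \<phi>)"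
    by (simp add: op_norm_def image_image \<psi>)
  moreover have "the_inv_into (\<phi> ` Y) g (g (\<phi> y)) = \<phi> y"
      "the_inv_into Y (g \<circ> \<phi>) (g (\<phi> y)) = y" if "y \<in> Y" for y
    using that g(2) inj' by (auto simp: the_inv_into_f_f the_inv_into_f_eq)
  then have "op_norm (g ` \<phi> ` Y) norm (N \<circ> \<psi>) (the_inv_into (\<phi> ` Y) g) =
      op_norm ((g \<circ> \<phi>) ` Y) norm N (the_inv_into Y (g \<circ> \<phi>))"
    by (simp add: op_norm_def image_image \<psi>)
  moreover have "linear_op_on s t Y (g \<circ> \<phi>)"
    using g(1) by (auto simp: linear_op_on_def l.add l.scale)
  moreover have "\<forall>x\<in>X. (g \<circ> \<phi>) x = f x"
    using g(3) X(2) \<psi> by (auto simp: subset_iff)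
  ultimately show "\<exists>g. linear_op_on s t Y g \<and> inj_on g Y \<and> (\<forall>x\<in>X. g x = f x) \<and>
      op_norm Y N norm g * op_norm (g ` Y) norm N (the_inv_into Y g) < 1 + \<epsilon>"
    using inj' g(4) by (intro exI[of _ "g \<circ> \<phi>"]) simp
qed

end

theory Submission
  imports Defs
begin

text \<open>
The map \<open>h\<close> is the limit of a back-and-forth construction between \<open>E\<close> and \<open>F\<close>, in which each step
repairs the isometric defect of the previous one.

The key point is that an approximate isometry \<open>f\<close> from \<open>X\<close> to \<open>Y\<close> with defect \<open>\<eta>\<close> becomes close to the
identity in a suitable common superspace: there is a norm on \<open>X \<times> Y\<close> that extends the norms of \<open>X\<close>
and of \<open>Y\<close> and in which \<open>x\<close> and \<open>f x\<close> are at distance at most \<open>\<eta> * norm x\<close> (locale \<open>amalgam\<close>). If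
\<open>X\<close> is a subspace of a Gurarii space \<open>E\<close>, then the inclusion of \<open>X\<close> extends almost isometrically to
this superspace. Restricting the extension to \<open>Y\<close> yields a map \<open>g\<close> from \<open>Y\<close> to \<open>E\<close>, as close to
isometric as desired, for which \<open>g (f x)\<close> differs from \<open>x\<close> by little more than \<open>\<eta> * norm x\<close>
(\<open>gurarii_approx_inverse\<close>).

Applying this twice, the second time with \<open>F\<close> as the Gurarii space and \<open>g\<close> as the map, replaces \<open>f\<close>
by a map \<open>f'\<close> on a larger space \<open>X'\<close> that is isometric up to a prescribed \<open>\<kappa>\<close> and differs from \<open>f\<close>
on \<open>X\<close> by at most \<open>\<eta> + \<kappa>\<close>. On the way one can absorb any finite set of vectors of \<open>E\<close> into \<open>X'\<close> and
bring the range of \<open>f'\<close> close to any finite set of vectors of \<open>F\<close> (\<open>back_and_forth_step\<close>). Iterating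
with a geometric sequence of defects and with dense sequences of \<open>E\<close> and \<open>F\<close>, the maps converge to an
isometry on all of \<open>E\<close> (\<open>limit_of_approx_isometries\<close>). Its range is dense and closed, so it is
bijective.

The total distance from \<open>f\<close> to the limit is the initial defect plus an arbitrarily small amount.
Compactness of the unit sphere of \<open>X\<close> gives \<open>f\<close> a defect \<open>\<eta> < \<epsilon>\<close>
(\<open>eps_isometry_imp_approx_isometry\<close>), and this is why the distance stays strictly below \<open>\<epsilon>\<close>.
\<close>

section \<open>Finite dimensional spaces over the scalar field\<close>

text \<open>The embedding into the complex numbers is isometric with closed range, so it carries the ball onto a
closed subset of a complex ball.\<close>

lemma compact_cball_scalars: "compact (cball (0::'k::real_or_complex) r)"
proof -
  obtain \<phi> :: "'k \<Rightarrow> complex" where add: "\<And>x y. \<phi> (x + y) = \<phi> x + \<phi> y"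
    and norm: "\<And>x. norm (\<phi> x) = norm x" and range: "range \<phi> = \<real> \<or> range \<phi> = UNIV"
    using ex_embedding_complex[where 'a = 'k] by blast
  have diff: "\<phi> (x - y) = \<phi> x - \<phi> y" for x y
    using add[of "x - y" y] by simp
  have dist: "dist (\<phi> x) (\<phi> y) = dist x y" for x y
    by (simp add: dist_norm norm flip: diff)
  have inj: "inj \<phi>"
    by (rule injI) (metis dist dist_eq_0_iff)
  have "\<phi> ` cball 0 r = cball 0 r \<inter> range \<phi>"
    by (auto simp: norm)
  moreover have "closed (range \<phi>)"
    using range closed_complex_Reals by auto
  ultimately have "compact (\<phi> ` cball 0 r)"
    by (simp add: compact_Int_closed)
  moreover have "continuous_on (\<phi> ` cball 0 r) (inv \<phi>)"
    unfolding continuous_on_iff using inj by (force simp: dist)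
  ultimately have "compact (inv \<phi> ` \<phi> ` cball 0 r)"
    by (rule compact_continuous_image[rotated])
  then show ?thesis
    using inj by (simp add: image_inv_f_f)
qed

text \<open>Tychonoff's theorem in the product topology on functions; pinning the coefficients outside \<open>B\<close>
to \<open>0\<close> makes every factor compact.\<close>

lemma compact_coefficients:
  "compact {c :: 'v \<Rightarrow> 'k::real_or_complex. (\<forall>b\<in>B. norm (c b) \<le> r) \<and> (\<forall>b. b \<notin> B \<longrightarrow> c b = 0)}"
proof -
  let ?S = "\<lambda>b. if b \<in> B then cball (0::'k) r else {0}"
  have "compactin (product_topology (\<lambda>_. euclidean) UNIV) (PiE UNIV ?S)"
    unfolding compactin_PiE by (auto simp: compact_cball_scalars)
  then have "compact (PiE UNIV ?S)"
    by (simp add: euclidean_product_topology)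
  also have "PiE UNIV ?S = {c. (\<forall>b\<in>B. norm (c b) \<le> r) \<and> (\<forall>b. b \<notin> B \<longrightarrow> c b = 0)}"
    by (auto simp: PiE_def Pi_def split: if_splits)
  finally show ?thesis .
qed

lemma norm_on_zero: "norm_on s V N \<Longrightarrow> 0 \<in> V \<Longrightarrow> N 0 = 0"
  by (simp add: norm_on_def)

lemma norm_on_nonneg: "norm_on s V N \<Longrightarrow> x \<in> V \<Longrightarrow> 0 \<le> N x"
  by (simp add: norm_on_def)

lemma norm_on_scale: "norm_on s V N \<Longrightarrow> x \<in> V \<Longrightarrow> N (s c x) = norm c * N x"
  by (simp add: norm_on_def)

lemma norm_on_triangle: "norm_on s V N \<Longrightarrow> x \<in> V \<Longrightarrow> y \<in> V \<Longrightarrow> N (x + y) \<le> N x + N y"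
  by (simp add: norm_on_def)

lemma norm_on_eq_0: "norm_on s V N \<Longrightarrow> x \<in> V \<Longrightarrow> N x = 0 \<longleftrightarrow> x = 0"
  by (simp add: norm_on_def)

lemma seminorm_sum_le:
  fixes s :: "'k::real_or_complex \<Rightarrow> 'v::ab_group_add \<Rightarrow> 'v"
  assumes "vector_space s" and V: "module.subspace s V" and B: "B \<subseteq> V" "finite B"
    and tri: "\<And>x y. x \<in> V \<Longrightarrow> y \<in> V \<Longrightarrow> M (x + y) \<le> M x + M y"
    and sc: "\<And>c x. x \<in> V \<Longrightarrow> M (s c x) = norm c * (M x :: real)"
  shows "M (\<Sum>b\<in>B. s (c b) b) \<le> (\<Sum>b\<in>B. norm (c b) * M b)"
proof -
  interpret vector_space s by fact
  show ?thesis using B(2,1)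
  proof (induction B rule: finite_induct)
    case empty
    have "M (s 0 0) = 0" using sc[of 0 0] subspace_0[OF V] by simp
    then show ?case by simp
  next
    case (insert b B)
    have mem: "s (c b) b \<in> V" "(\<Sum>b\<in>B. s (c b) b) \<in> V"
      using insert.prems by (auto intro!: subspace_scale[OF V] subspace_sum[OF V])
    show ?case
      using insert tri[OF mem] sc[of b "c b"] by simp
  qed
qed

text \<open>For a basis \<open>B\<close>, the norm is a continuous function of the coefficients, and independence makes
it positive on the compact set of coefficient families whose largest entry has modulus \<open>1\<close>; \<open>m\<close> is
its minimum there, and homogeneity does the rest. Both finite dimensional facts that follow,
boundedness of seminorms and compactness of spheres, are read off from these coordinates.\<close>

lemma fin_dim_coordinates:
  fixes s :: "'k::real_or_complex \<Rightarrow> 'v::ab_group_add \<Rightarrow> 'v"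
  assumes "vector_space s" and fd: "fin_dim_subspace s V" and N: "norm_on s V N"
  obtains B m where "finite B" "B \<subseteq> V" "0 < m"
    "\<And>x. x \<in> V \<Longrightarrow> \<exists>c. x = (\<Sum>b\<in>B. s (c b) b) \<and> (\<forall>b. b \<notin> B \<longrightarrow> c b = 0) \<and>
        (\<forall>b\<in>B. norm (c b) \<le> N x / m)"
proof -
  interpret vector_space s by fact
  have V: "subspace V" using fd by (simp add: fin_dim_subspace_def)
  obtain A where A: "finite A" "span A = V" using fd by (auto simp: fin_dim_subspace_def)
  obtain B where B: "B \<subseteq> A" "independent B" "A \<subseteq> span B"
    by (rule maximal_independent_subset)
  have fB: "finite B" using A(1) B(1) by (rule rev_finite_subset)
  have VB: "V = span B" using A B span_eq span_mono span_span by (metis subset_antisym)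
  have BV: "B \<subseteq> V" unfolding VB by (rule span_superset)
  define L where "L c = (\<Sum>b\<in>B. s (c b) b)" for c
  have LV: "L c \<in> V" for c
    unfolding L_def using BV by (auto intro!: subspace_sum[OF V] subspace_scale[OF V])
  have Lscale: "L (\<lambda>b. a * c b) = s a (L c)" for a c
    by (simp add: L_def scale_sum_right)
  have L0: "\<forall>b\<in>B. c b = 0" if "L c = 0" for c
    using that independentD[OF B(2) fB subset_refl] unfolding L_def by blast
  have NL: "N (L c) \<le> (\<Sum>b\<in>B. norm (c b) * N b)" for c
    unfolding L_def using N norm_on_scale[OF N] norm_on_triangle[OF N]
    by (intro seminorm_sum_le[OF assms(1) V BV fB]) auto
  have Ldiff: "L c = L d + L (\<lambda>b. c b - d b)" for c d
    by (simp add: L_def flip: sum.distrib scale_left_distrib)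
  have diff: "\<bar>N (L c) - N (L d)\<bar> \<le> (\<Sum>b\<in>B. norm (c b - d b) * N b)" for c d
  proof -
    \<comment> \<open>The reverse triangle inequality, before exchanging the two arguments.\<close>
    have "N (L c) \<le> N (L d) + (\<Sum>b\<in>B. norm (c b - d b) * N b)" for c d
      using norm_on_triangle[OF N LV LV, of d "\<lambda>b. c b - d b"] NL[of "\<lambda>b. c b - d b"] Ldiff[of c d]
      by simp
    from this[of c d] this[of d c] show ?thesis
      by (simp add: norm_minus_commute)
  qed
  have cont: "continuous_on UNIV (\<lambda>c. N (L c))"
    unfolding continuous_on_def
  proof
    fix d :: "'v \<Rightarrow> 'k"
    have "((\<lambda>c. \<Sum>b\<in>B. norm (c b - d b) * N b) \<longlongrightarrow> (\<Sum>b\<in>B. norm (d b - d b) * N b)) (at d)"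
      by (intro tendsto_intros) (rule continuous_on_product_coordinates[unfolded continuous_on_def,
            rule_format, OF UNIV_I])
    then have lim: "((\<lambda>c. \<Sum>b\<in>B. norm (c b - d b) * N b) \<longlongrightarrow> 0) (at d)"
      by simp
    show "((\<lambda>c. N (L c)) \<longlongrightarrow> N (L d)) (at d)"
      by (rule LIM_zero_cancel, rule tendsto_0_le[OF lim, of _ 1])
         (use diff in \<open>auto intro!: always_eventually order_trans[OF diff]\<close>)
  qed
  define K where "K = {c :: 'v \<Rightarrow> 'k. (\<forall>b\<in>B. norm (c b) \<le> 1) \<and> (\<forall>b. b \<notin> B \<longrightarrow> c b = 0)}"
  define S where "S = K \<inter> (\<Union>b\<in>B. {c. norm (c b) = 1})"
  have "closed (\<Union>b\<in>B. {c :: 'v \<Rightarrow> 'k. norm (c b) = 1})"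
    by (intro closed_UN fB ballI closed_Collect_eq continuous_on_norm continuous_on_const
        continuous_on_product_coordinates)
  then have "compact S"
    unfolding S_def K_def by (intro compact_Int_closed compact_coefficients)
  have "\<exists>m>0. \<forall>c\<in>S. m \<le> N (L c)"
  proof (cases "S = {}")
    case True
    \<comment> \<open>\<open>S\<close> is empty exactly when \<open>B\<close> is, that is, when \<open>V\<close> is trivial.\<close>
    then show ?thesis by (auto intro: exI[of _ 1])
  next
    case False
    then obtain d where d: "d \<in> S" "\<forall>c\<in>S. N (L d) \<le> N (L c)"
      using continuous_attains_inf[OF \<open>compact S\<close> False continuous_on_subset[OF cont]] by blast
    have "L d \<noteq> 0" using L0[of d] d(1) by (auto simp: S_def)
    then have "0 < N (L d)"
      using norm_on_nonneg[OF N LV] norm_on_eq_0[OF N LV] by (simp add: less_le)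
    with d show ?thesis by blast
  qed
  then obtain m where m: "m > 0" "\<And>c. c \<in> S \<Longrightarrow> m \<le> N (L c)" by blast
  show ?thesis
  proof (rule that[OF fB BV m(1)])
    fix x assume x: "x \<in> V"
    then obtain u where u: "x = (\<Sum>b\<in>B. s (u b) b)"
      using VB span_finite[OF fB] by auto
    define c where "c b = (if b \<in> B then u b else 0)" for b
    have xc: "x = L c" by (simp add: u L_def c_def)
    have "norm (c a) \<le> N x / m" if a: "a \<in> B" for a
    proof -
      define r where "r = Max ((\<lambda>b. norm (c b)) ` B)"
      have r: "norm (c b) \<le> r" if "b \<in> B" for b
        unfolding r_def using fB that by auto
      show ?thesis
      proof (cases "r = 0")
        case True
        then show ?thesis using r[OF a] norm_on_nonneg[OF N x] m(1) by auto
      next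
        case False
        then have rpos: "r > 0" using r[OF a] by (smt (verit) norm_ge_zero)
        have "r \<in> (\<lambda>b. norm (c b)) ` B"
          unfolding r_def using fB a by (intro Max_in) auto
        then obtain b where b: "b \<in> B" "norm (c b) = r" by auto
        \<comment> \<open>Dividing by the largest modulus \<open>r\<close> moves the coefficients into \<open>S\<close>.\<close>
        have eq: "norm (of_real (inverse r) * c b) = norm (c b) / r" for b
          using rpos by (simp add: norm_mult norm_divide divide_inverse norm_inverse)
        have "\<forall>b\<in>B. norm (of_real (inverse r) * c b) \<le> 1"
          unfolding eq using rpos r by simp
        moreover have "norm (of_real (inverse r) * c b) = 1"
          unfolding eq using rpos b(2) by simp
        moreover have "\<forall>b. b \<notin> B \<longrightarrow> of_real (inverse r) * c b = 0"
          by (simp add: c_def)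
        ultimately have "(\<lambda>b. of_real (inverse r) * c b) \<in> S"
          unfolding S_def K_def using b(1) by blast
        from m(2)[OF this] have "m \<le> inverse r * N x"
          using rpos by (simp only: Lscale norm_on_scale[OF N LV] xc) (simp add: norm_inverse)
        then have "r \<le> N x / m" using rpos m(1) by (simp add: field_simps)
        with r[OF a] show ?thesis by simp
      qed
    qed
    then show "\<exists>c. x = (\<Sum>b\<in>B. s (c b) b) \<and> (\<forall>b. b \<notin> B \<longrightarrow> c b = 0) \<and>
        (\<forall>b\<in>B. norm (c b) \<le> N x / m)"
      by (intro exI[of _ c]) (auto simp: xc L_def c_def)
  qed
qed

lemma fin_dim_seminorm_bounded:
  fixes s :: "'k::real_or_complex \<Rightarrow> 'v::ab_group_add \<Rightarrow> 'v"
  assumes "vector_space s" and fd: "fin_dim_subspace s V" and N: "norm_on s V N"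
    and tri: "\<And>x y. x \<in> V \<Longrightarrow> y \<in> V \<Longrightarrow> M (x + y) \<le> M x + M y"
    and sc: "\<And>c x. x \<in> V \<Longrightarrow> M (s c x) = norm c * (M x :: real)"
  shows "\<exists>C. \<forall>x\<in>V. M x \<le> C * N x"
proof -
  obtain B m where B: "finite B" "B \<subseteq> V" "0 < m" and
    coord: "\<And>x. x \<in> V \<Longrightarrow> \<exists>c. x = (\<Sum>b\<in>B. s (c b) b) \<and> (\<forall>b. b \<notin> B \<longrightarrow> c b = 0) \<and>
        (\<forall>b\<in>B. norm (c b) \<le> N x / m)"
    by (rule fin_dim_coordinates[OF assms(1) fd N]) blast
  have V: "module.subspace s V" using fd by (simp add: fin_dim_subspace_def)
  show ?thesis
  proof (intro exI ballI)
    fix x assume x: "x \<in> V"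
    then obtain c where c: "x = (\<Sum>b\<in>B. s (c b) b)" "\<forall>b\<in>B. norm (c b) \<le> N x / m"
      using coord by blast
    have "M x \<le> (\<Sum>b\<in>B. norm (c b) * M b)"
      unfolding c(1) by (rule seminorm_sum_le[OF assms(1) V B(2,1) tri sc])
    also have "\<dots> \<le> (\<Sum>b\<in>B. norm (c b) * \<bar>M b\<bar>)"
      by (intro sum_mono mult_left_mono) auto
    also have "\<dots> \<le> (\<Sum>b\<in>B. N x / m * \<bar>M b\<bar>)"
      using c(2) by (intro sum_mono mult_right_mono) auto
    also have "\<dots> = ((\<Sum>b\<in>B. \<bar>M b\<bar>) / m) * N x"
      by (simp add: sum_divide_distrib sum_distrib_left sum_distrib_right mult.commute)
    finally show "M x \<le> ((\<Sum>b\<in>B. \<bar>M b\<bar>) / m) * N x" .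
  qed
qed

lemma compact_unit_sphere:
  fixes s :: "'k::real_or_complex \<Rightarrow> 'e::banach \<Rightarrow> 'e"
  assumes "banach_over s" and fd: "fin_dim_subspace s X"
  shows "compact {x \<in> X. norm x = 1}"
proof -
  interpret banach_over s by fact
  have X: "subspace X" using fd by (simp add: fin_dim_subspace_def)
  obtain B m where B: "finite B" "B \<subseteq> X" "0 < m" and
    coord: "\<And>x. x \<in> X \<Longrightarrow> \<exists>c. x = (\<Sum>b\<in>B. s (c b) b) \<and> (\<forall>b. b \<notin> B \<longrightarrow> c b = 0) \<and>
        (\<forall>b\<in>B. norm (c b) \<le> norm x / m)"
    by (rule fin_dim_coordinates[OF vector_space_axioms fd norm_on_norm[OF assms(1)]]) blast
  define K where "K = {c :: 'e \<Rightarrow> 'k. (\<forall>b\<in>B. norm (c b) \<le> 1 / m) \<and> (\<forall>b. b \<notin> B \<longrightarrow> c b = 0)}"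
  define L where "L c = (\<Sum>b\<in>B. s (c b) b)" for c
  have bl: "bounded_linear (\<lambda>a. s a b)" for b
  proof (rule bounded_linear_intro[of _ "norm b"])
    show "s (r *\<^sub>R a) b = r *\<^sub>R s a b" for r a
      by (simp add: scaleR_conv_of_real flip: scale_of_real)
  qed (auto simp: scale_left_distrib norm_scale)
  have "continuous_on K (\<lambda>c. s (c b) b)" for b
    by (rule bounded_linear.continuous_on[OF bl])
       (rule continuous_on_subset[OF continuous_on_product_coordinates subset_UNIV])
  then have "continuous_on K L"
    unfolding L_def by (rule continuous_on_sum)
  then have "compact (L ` K)"
    unfolding K_def by (intro compact_continuous_image compact_coefficients)
  then have "compact (L ` K \<inter> {x. norm x = 1})"
    by (intro compact_Int_closed closed_Collect_eq continuous_intros)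
  also have "L ` K \<inter> {x. norm x = 1} = {x \<in> X. norm x = 1}"
  proof (intro equalityI subsetI)
    show "x \<in> {x \<in> X. norm x = 1}" if "x \<in> L ` K \<inter> {x. norm x = 1}" for x
      using that B(2) by (auto simp: L_def intro!: subspace_sum[OF X] subspace_scale[OF X])
    show "x \<in> L ` K \<inter> {x. norm x = 1}" if "x \<in> {x \<in> X. norm x = 1}" for x
      using that coord[of x] by (auto simp: L_def K_def image_iff)
  qed
  finally show ?thesis .
qed

section \<open>Approximate isometries into Gurarii spaces\<close>

text \<open>The homogeneous form of \<open>eps_isometry\<close>, with non-strict inequalities: it is stated for
all vectors rather than unit vectors, and it survives passing to limits.\<close>

definition approx_isometry ::
    "('k::real_or_complex \<Rightarrow> 'v::ab_group_add \<Rightarrow> 'v) \<Rightarrow> ('k \<Rightarrow> 'w::ab_group_add \<Rightarrow> 'w) \<Rightarrow>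
     'v set \<Rightarrow> ('v \<Rightarrow> real) \<Rightarrow> ('w \<Rightarrow> real) \<Rightarrow> real \<Rightarrow> ('v \<Rightarrow> 'w) \<Rightarrow> bool"
  where "approx_isometry s t V N M \<delta> f \<longleftrightarrow>
    linear_op_on s t V f \<and> (\<forall>x\<in>V. N x \<le> (1 + \<delta>) * M (f x) \<and> M (f x) \<le> (1 + \<delta>) * N x)"

lemma approx_isometryD:
  assumes "approx_isometry s t V N M \<delta> f"
  shows "linear_op_on s t V f"
    and "x \<in> V \<Longrightarrow> N x \<le> (1 + \<delta>) * M (f x)"
    and "x \<in> V \<Longrightarrow> M (f x) \<le> (1 + \<delta>) * N x"
  using assms by (auto simp: approx_isometry_def)

lemma linear_op_on_add: "linear_op_on s t V f \<Longrightarrow> x \<in> V \<Longrightarrow> y \<in> V \<Longrightarrow> f (x + y) = f x + f y"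
  by (simp add: linear_op_on_def)

lemma linear_op_on_scale: "linear_op_on s t V f \<Longrightarrow> x \<in> V \<Longrightarrow> f (s c x) = t c (f x)"
  by (simp add: linear_op_on_def)

lemma linear_op_on_diff:
  assumes "vector_space s" "vector_space t" "linear_op_on s t V f" "module.subspace s V"
    and "x \<in> V" "y \<in> V"
  shows "f (x - y) = f x - f y"
proof -
  interpret s: vector_space s by fact
  have "f (x - y) + f y = f x"
    using linear_op_on_add[OF assms(3), of "x - y" y] assms(5,6) s.subspace_diff[OF assms(4)] by simp
  then show ?thesis by (simp add: eq_diff_eq)
qed

lemma linear_op_on_zero:
  assumes "vector_space s" "vector_space t" "linear_op_on s t V f" "module.subspace s V"
  shows "f 0 = 0"
proof -
  interpret s: vector_space s by fact
  show ?thesis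
    using linear_op_on_diff[OF assms, of 0 0] s.subspace_0[OF assms(4)] by simp
qed

text \<open>Some bound \<open>C\<close> has to be known beforehand, since the supremum in \<open>op_norm\<close> is meaningless for an
unbounded operator.\<close>

lemma op_norm_bound:
  assumes "\<And>x. x \<in> V \<Longrightarrow> M (f x) \<le> C * N x" "\<And>x. x \<in> V \<Longrightarrow> 0 \<le> N x" and x: "x \<in> V"
  shows "M (f x) \<le> op_norm V N M f * N x"
proof (cases "N x = 0")
  case True
  then show ?thesis using assms(1)[OF x] by simp
next
  case False
  then have pos: "0 < N x" using assms(2)[OF x] by simp
  have "M (f y) / N y \<le> max C 0" if "y \<in> V" for y
  proof (cases "N y = 0")
    case False
    then have "0 < N y" using assms(2)[OF that] by simp
    moreover have "M (f y) \<le> max C 0 * N y"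
      using assms(1)[OF that] assms(2)[OF that] mult_right_mono[of C "max C 0" "N y"] by simp
    ultimately show ?thesis by (simp add: pos_divide_le_eq)
  qed simp
  then have "bdd_above ((\<lambda>x. M (f x) / N x) ` V)" by (rule bdd_aboveI2)
  then have "M (f x) / N x \<le> op_norm V N M f"
    unfolding op_norm_def by (rule cSUP_upper[OF x])
  then show ?thesis using pos by (simp add: field_simps)
qed

text \<open>The Gurarii property controls only the product \<open>a * b\<close> of the norms of \<open>g\<close> and of its inverse. If \<open>X\<close>
is nontrivial, then \<open>g\<close> preserves the norm of a nonzero vector, so both factors are at least \<open>1\<close> and hence each is
below \<open>1 + \<delta>\<close>. If \<open>X\<close> is trivial, then \<open>g\<close> may be rescaled without spoiling the extension
property; unless \<open>Y\<close> is trivial as well, dividing by \<open>a\<close> makes the two factors \<open>1\<close> and \<open>a * b\<close>.\<close>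

lemma gurarii_approx_isometry_extension:
  fixes s :: "'k::real_or_complex \<Rightarrow> 'v::ab_group_add \<Rightarrow> 'v" and t :: "'k \<Rightarrow> 'g::banach \<Rightarrow> 'g"
  assumes G: "gurarii_space t" and s: "vector_space s"
    and Y: "fin_dim_subspace s Y" and N: "norm_on s Y N"
    and X: "module.subspace s X" "X \<subseteq> Y" and f: "isometry_op s t X N norm f" and \<delta>: "0 < \<delta>"
  obtains g where "approx_isometry s t Y N norm \<delta> g" "\<And>x. x \<in> X \<Longrightarrow> g x = f x"
proof -
  interpret s: vector_space s by fact
  interpret t: banach_over t using G by (simp add: gurarii_space_def)
  have sY: "s.subspace Y" using Y by (simp add: fin_dim_subspace_def)
  have "gurarii_extension s t" by (rule gurarii_space_extension[OF G s])
  from this[unfolded gurarii_extension_def, THEN spec, THEN spec, THEN spec, THEN spec, THEN spec,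
      THEN mp, OF conjI[OF Y conjI[OF N conjI[OF X(1) conjI[OF X(2) conjI[OF \<delta> f]]]]]]
  obtain g where g: "linear_op_on s t Y g" "inj_on g Y" "\<forall>x\<in>X. g x = f x"
      "op_norm Y N norm g * op_norm (g ` Y) norm N (the_inv_into Y g) < 1 + \<delta>"
    by blast
  define a where "a = op_norm Y N norm g"
  define b where "b = op_norm (g ` Y) norm N (the_inv_into Y g)"
  have ab: "a * b < 1 + \<delta>" using g(4) by (simp add: a_def b_def)
  have g0: "g 0 = 0"
    by (rule linear_op_on_zero[OF s t.vector_space_axioms g(1) sY])
  have gz: "g x = 0 \<longleftrightarrow> x = 0" if "x \<in> Y" for x
    using g(2) g0 that s.subspace_0[OF sY] by (metis inj_onD)
  have N': "norm_on s Y (\<lambda>y. norm (g y))"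
    unfolding norm_on_def using gz linear_op_on_add[OF g(1)] linear_op_on_scale[OF g(1)]
    by (auto simp: t.norm_scale norm_triangle_ineq)
  \<comment> \<open>Both operator norms are suprema of bounded sets, because all norms on \<open>Y\<close> are equivalent.\<close>
  obtain C where C: "\<forall>y\<in>Y. norm (g y) \<le> C * N y"
    using fin_dim_seminorm_bounded[OF s Y N, of "\<lambda>y. norm (g y)"]
      norm_on_triangle[OF N'] norm_on_scale[OF N'] by auto
  obtain D where D: "\<forall>y\<in>Y. N y \<le> D * norm (g y)"
    using fin_dim_seminorm_bounded[OF s Y N', of N] norm_on_triangle[OF N] norm_on_scale[OF N] by auto
  have upper: "norm (g y) \<le> a * N y" if "y \<in> Y" for y
    unfolding a_def by (rule op_norm_bound) (use C norm_on_nonneg[OF N] that in auto)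
  have lower: "N y \<le> b * norm (g y)" if "y \<in> Y" for y
  proof -
    have inv: "the_inv_into Y g (g y) = y" if "y \<in> Y" for y
      using g(2) that by (rule the_inv_into_f_f)
    have "N (the_inv_into Y g (g y)) \<le> b * norm (g y)"
      unfolding b_def by (rule op_norm_bound[of _ _ _ D]) (use D that inv in auto)
    then show ?thesis using inv that by simp
  qed
  show ?thesis
  proof (cases "\<exists>x\<in>X. x \<noteq> 0")
    case True
    then obtain x where x: "x \<in> X" "x \<noteq> 0" by blast
    then have xY: "x \<in> Y" and gx: "norm (g x) = N x" and Nx: "0 < N x"
      using X g(3) f N by (auto simp: isometry_op_def norm_on_def less_le)
    have "1 \<le> a" "1 \<le> b" using upper[OF xY] lower[OF xY] gx Nx by auto
    then have "a \<le> 1 + \<delta>" "b \<le> 1 + \<delta>"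
      using ab mult_left_mono[of 1 b a] mult_right_mono[of 1 a b] by linarith+
    then have "norm (g y) \<le> (1 + \<delta>) * N y" "N y \<le> (1 + \<delta>) * norm (g y)" if "y \<in> Y" for y
      using upper[OF that] lower[OF that] norm_on_nonneg[OF N that]
      by (meson mult_right_mono norm_ge_zero order_trans)+
    then show ?thesis
      using g by (intro that[of g]) (auto simp: approx_isometry_def)
  next
    case False
    show ?thesis
    proof (cases "\<exists>y\<in>Y. y \<noteq> 0")
      case True
      then obtain y where y: "y \<in> Y" "y \<noteq> 0" by blast
      then have "0 < N y" "0 < norm (g y)" using N gz[OF y(1)] by (auto simp: norm_on_def less_le)
      then have "0 < a * N y" "0 < b * norm (g y)" using upper[OF y(1)] lower[OF y(1)] by linarith+
      then have pos: "0 < a" "0 < b" using \<open>0 < N y\<close> \<open>0 < norm (g y)\<close>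
        by (auto simp: zero_less_mult_iff)
      define h where "h y = t (of_real (inverse a)) (g y)" for y
      have nh: "norm (h y) = inverse a * norm (g y)" for y
        using pos by (simp add: h_def t.norm_scale norm_inverse)
      have "linear_op_on s t Y h"
        unfolding h_def linear_op_on_def using g(1)
        by (auto simp: linear_op_on_def t.scale_right_distrib mult.commute)
      moreover have "norm (h y) \<le> (1 + \<delta>) * N y \<and> N y \<le> (1 + \<delta>) * norm (h y)" if "y \<in> Y" for y
      proof
        have "norm (h y) \<le> N y" using upper[OF that] pos by (simp add: nh field_simps)
        then show "norm (h y) \<le> (1 + \<delta>) * N y"
          using \<delta> norm_on_nonneg[OF N that] by (simp add: distrib_right add_increasing2)
        have "N y \<le> (a * b) * norm (h y)" using lower[OF that] pos by (simp add: nh field_simps)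
        then show "N y \<le> (1 + \<delta>) * norm (h y)"
          using ab by (meson less_imp_le mult_right_mono norm_ge_zero order_trans)
      qed
      moreover have "h x = f x" if "x \<in> X" for x
        using that False g(3) g0 by (auto simp: h_def)
      ultimately show ?thesis by (intro that[of h]) (auto simp: approx_isometry_def)
    next
      case Y0: False
      then show ?thesis
        using g g0 norm_on_zero[OF N] by (intro that[of g]) (auto simp: approx_isometry_def)
    qed
  qed
qed

section \<open>Finite dimensional products and images\<close>

lemma fin_dim_subspaceI:
  assumes "vector_space s" "finite B"
  shows "fin_dim_subspace s (module.span s B)"
proof -
  interpret vector_space s by fact
  show ?thesis using assms(2) by (auto simp: fin_dim_subspace_def)
qed

lemma fin_dim_Times:
  assumes "vector_space_pair s t" "fin_dim_subspace s X" "fin_dim_subspace t Y"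
  shows "fin_dim_subspace (module_prod.scale s t) (X \<times> Y)"
proof -
  interpret vector_space_pair s t by fact
  interpret vector_space_prod s t ..
  obtain A B where AB: "finite A" "vs1.span A = X" "finite B" "vs2.span B = Y"
    using assms(2,3) by (auto simp: fin_dim_subspace_def)
  have "p.span (A \<times> {0} \<union> {0} \<times> B) = X \<times> Y"
    unfolding p.span_Un span_Times_sing1 span_Times_sing2 AB by force
  then show ?thesis
    using fin_dim_subspaceI[OF p.vector_space_axioms, of "A \<times> {0} \<union> {0} \<times> B"] AB by simp
qed

lemma linear_image_span:
  assumes "vector_space s" "vector_space t" and f: "linear_op_on s t V f"
    and V: "module.subspace s V" and B: "module.span s B = V"
  shows "f ` V = module.span t (f ` B)"
proof -
  interpret s: vector_space s by fact
  interpret t: vector_space t by fact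
  have f0: "f 0 = 0" by (rule linear_op_on_zero[OF assms(1,2) f V])
  show ?thesis
  proof
    have "s.subspace {x \<in> V. f x \<in> t.span (f ` B)}"
      by (rule s.subspaceI) (auto simp: f0 s.subspace_0[OF V] s.subspace_add[OF V]
          s.subspace_scale[OF V] t.span_zero t.span_add t.span_scale
          linear_op_on_add[OF f] linear_op_on_scale[OF f])
    moreover have "B \<subseteq> {x \<in> V. f x \<in> t.span (f ` B)}"
      using B s.span_superset t.span_superset by fast
    ultimately have "V \<subseteq> {x \<in> V. f x \<in> t.span (f ` B)}"
      using s.span_minimal B by metis
    then show "f ` V \<subseteq> t.span (f ` B)" by auto
    have "t.subspace (f ` V)"
    proof (rule t.subspaceI)
      show "0 \<in> f ` V" using f0 s.subspace_0[OF V] by (metis imageI)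
      show "x + y \<in> f ` V" if "x \<in> f ` V" "y \<in> f ` V" for x y
        using that linear_op_on_add[OF f] s.subspace_add[OF V] by (auto simp: image_iff) metis
      show "t c x \<in> f ` V" if "x \<in> f ` V" for c x
        using that linear_op_on_scale[OF f] s.subspace_scale[OF V] by (auto simp: image_iff) metis
    qed
    then show "t.span (f ` B) \<subseteq> f ` V"
      using B s.span_superset by (intro t.span_minimal) auto
  qed
qed

section \<open>Amalgamating along an approximate isometry\<close>

text \<open>On pairs with first entry in \<open>X\<close>, for linear \<open>f\<close> and \<open>\<eta> > 0\<close>, this is the norm whose unit ball
is generated by the unit balls of the two factors together with the vectors \<open>(w, - f w)\<close> for \<open>w\<close> in
\<open>X\<close> with \<open>norm w \<le> 1 / \<eta>\<close>: in a decomposition \<open>(x, y) = (u, 0) + (0, v) + (w, - f w)\<close> the summands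
\<open>u\<close> and \<open>v\<close> are determined by \<open>w\<close>, so the infimum runs over \<open>w\<close> alone.\<close>

definition amalgam_norm ::
    "'e::real_normed_vector set \<Rightarrow> ('e \<Rightarrow> 'f::real_normed_vector) \<Rightarrow> real \<Rightarrow> 'e \<times> 'f \<Rightarrow> real"
  where "amalgam_norm X f \<eta> z =
    (INF w\<in>X. norm (fst z - w) + norm (snd z + f w) + \<eta> * norm w)"

lemma amalgam_norm_le:
  assumes "0 \<le> \<eta>" "w \<in> X"
  shows "amalgam_norm X f \<eta> (x, y) \<le> norm (x - w) + norm (y + f w) + \<eta> * norm w"
  unfolding amalgam_norm_def fst_conv snd_conv
  by (rule cINF_lower[OF _ assms(2)], rule bdd_belowI2[of _ 0]) (use assms(1) in auto)

lemma amalgam_norm_ge: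
  assumes "X \<noteq> {}" "\<And>w. w \<in> X \<Longrightarrow> K \<le> norm (x - w) + norm (y + f w) + \<eta> * norm w"
  shows "K \<le> amalgam_norm X f \<eta> (x, y)"
  unfolding amalgam_norm_def fst_conv snd_conv by (rule cINF_greatest) (use assms in auto)

text \<open>If \<open>f\<close> is isometric up to \<open>\<eta>\<close>, then the penalty \<open>\<eta>\<close> on \<open>w\<close> is large enough that no
decomposition shortens a vector of either factor, so both embed isometrically; and it makes \<open>(x, 0)\<close>
and \<open>(0, f x)\<close> at most \<open>\<eta> * norm x\<close> apart.\<close>

locale amalgam =
  fixes sE :: "'k::real_or_complex \<Rightarrow> 'e::banach \<Rightarrow> 'e" and sF :: "'k \<Rightarrow> 'f::banach \<Rightarrow> 'f"
    and X :: "'e set" and f :: "'e \<Rightarrow> 'f" and \<eta> :: real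
  assumes E: "banach_over sE" and F: "banach_over sF" and X: "module.subspace sE X"
    and f: "approx_isometry sE sF X norm norm \<eta> f" and \<eta>: "0 < \<eta>"
begin

interpretation E: banach_over sE by (rule E)
interpretation F: banach_over sF by (rule F)
sublocale P: vector_space_prod sE sF ..

abbreviation "N \<equiv> amalgam_norm X f \<eta>"

lemma X_nonempty: "X \<noteq> {}" using E.subspace_0[OF X] by auto

lemmas f_linear = approx_isometryD(1)[OF f]

lemma f_zero: "f 0 = 0"
  by (rule linear_op_on_zero[OF E.vector_space_axioms F.vector_space_axioms f_linear X])

text \<open>A detour through \<open>w\<close> does not pay because \<open>norm w \<le> norm (f w) + \<eta> * norm w\<close>: if \<open>f\<close> shrinks
\<open>w\<close>, then \<open>norm w \<le> norm (f w) + \<eta> * norm (f w) \<le> norm (f w) + \<eta> * norm w\<close>, and otherwise this is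
clear.\<close>

lemma amalgam_norm_left:
  assumes "x \<in> X" shows "N (x, 0) = norm x"
proof (rule antisym)
  show "N (x, 0) \<le> norm x"
    using amalgam_norm_le[of \<eta> 0 X f x 0] \<eta> E.subspace_0[OF X] by (simp add: f_zero)
  show "norm x \<le> N (x, 0)"
  proof (rule amalgam_norm_ge[OF X_nonempty])
    fix w assume w: "w \<in> X"
    have "norm x \<le> norm (x - w) + norm w" by (metis add.commute norm_triangle_sub)
    moreover have "norm w \<le> norm (f w) + \<eta> * norm w"
    proof -
      note lower = approx_isometryD(2)[OF f w]
      show ?thesis
      proof (cases "norm (f w) \<le> norm w")
        case True
        then have "\<eta> * norm (f w) \<le> \<eta> * norm w" using \<eta> by simp
        with lower show ?thesis by (simp add: distrib_right)
      next
        case False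
        moreover have "0 \<le> \<eta> * norm w" using \<eta> by simp
        ultimately show ?thesis by linarith
      qed
    qed
    ultimately show "norm x \<le> norm (x - w) + norm (0 + f w) + \<eta> * norm w" by simp
  qed
qed

text \<open>Here a detour through \<open>w\<close> does not pay because \<open>norm (f w) \<le> norm w + \<eta> * norm w\<close>.\<close>

lemma amalgam_norm_right: "N (0, y) = norm y"
proof (rule antisym)
  show "N (0, y) \<le> norm y"
    using amalgam_norm_le[of \<eta> 0 X f 0 y] \<eta> E.subspace_0[OF X] by (simp add: f_zero)
  show "norm y \<le> N (0, y)"
  proof (rule amalgam_norm_ge[OF X_nonempty])
    fix w assume w: "w \<in> X"
    have "norm y \<le> norm (y + f w) + norm (f w)" by (metis add_diff_cancel norm_triangle_ineq4)
    with approx_isometryD(3)[OF f w]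
    show "norm y \<le> norm (0 - w) + norm (y + f w) + \<eta> * norm w" by (simp add: distrib_right)
  qed
qed

lemma amalgam_norm_graph:
  assumes "x \<in> X" shows "N (x, - f x) \<le> \<eta> * norm x"
  using amalgam_norm_le[of \<eta> x X f x "- f x"] \<eta> assms by simp

lemma amalgam_norm_triangle: "N (x + x', y + y') \<le> N (x, y) + N (x', y')"
proof -
  have "N (x + x', y + y') - (norm (x' - w') + norm (y' + f w') + \<eta> * norm w') \<le> N (x, y)"
    if w': "w' \<in> X" for w'
  proof (rule amalgam_norm_ge[OF X_nonempty])
    fix w assume w: "w \<in> X"
    have eq: "(x - w) + (x' - w') = x + x' - (w + w')"
        "(y + f w) + (y' + f w') = y + y' + f (w + w')"
      by (simp_all add: linear_op_on_add[OF f_linear w w'])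
    have "N (x + x', y + y') \<le>
        norm ((x - w) + (x' - w')) + norm ((y + f w) + (y' + f w')) + \<eta> * norm (w + w')"
      unfolding eq using \<eta> by (intro amalgam_norm_le E.subspace_add[OF X w w']) simp
    also have "\<dots> \<le> (norm (x - w) + norm (x' - w')) + (norm (y + f w) + norm (y' + f w')) +
        \<eta> * (norm w + norm w')"
      using \<eta> by (intro add_mono mult_left_mono norm_triangle_ineq) auto
    finally show "N (x + x', y + y') - (norm (x' - w') + norm (y' + f w') + \<eta> * norm w') \<le>
        norm (x - w) + norm (y + f w) + \<eta> * norm w"
      by (simp add: distrib_left)
  qed
  then have "N (x + x', y + y') - N (x, y) \<le> N (x', y')"
    by (intro amalgam_norm_ge[OF X_nonempty]) (simp add: algebra_simps)
  then show ?thesis by simp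
qed

lemma amalgam_norm_zero: "N (0, 0) = 0"
  using amalgam_norm_right[of 0] by simp

lemma amalgam_norm_scale: "N (sE c x, sF c y) = norm c * N (x, y)"
proof (cases "c = 0")
  case True
  then show ?thesis by (simp add: amalgam_norm_zero)
next
  case False
  have le: "N (sE c x, sF c y) \<le> norm c * N (x, y)" if "c \<noteq> 0" for c x y
  proof -
    have "N (sE c x, sF c y) / norm c \<le> N (x, y)"
    proof (rule amalgam_norm_ge[OF X_nonempty])
      fix w assume w: "w \<in> X"
      have "N (sE c x, sF c y) \<le> norm (sE c (x - w)) + norm (sF c (y + f w)) + \<eta> * norm (sE c w)"
        using amalgam_norm_le[of \<eta> "sE c w" X f "sE c x" "sF c y"] \<eta> E.subspace_scale[OF X w]
        by (simp add: linear_op_on_scale[OF f_linear w] E.scale_right_diff_distrib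
            F.scale_right_distrib)
      also have "\<dots> = norm c * (norm (x - w) + norm (y + f w) + \<eta> * norm w)"
        unfolding E.norm_scale F.norm_scale by (simp add: algebra_simps)
      finally show "N (sE c x, sF c y) / norm c \<le> norm (x - w) + norm (y + f w) + \<eta> * norm w"
        using that by (simp add: field_simps)
    qed
    then show ?thesis using that by (simp add: field_simps)
  qed
  have "N (x, y) \<le> norm (inverse c) * N (sE c x, sF c y)"
    using le[of "inverse c" "sE c x" "sF c y"] False by simp
  then have "N (x, y) \<le> N (sE c x, sF c y) / norm c"
    by (simp only: norm_inverse divide_inverse mult.commute)
  then have "norm c * N (x, y) \<le> N (sE c x, sF c y)"
    using False by (simp add: pos_le_divide_eq mult.commute)
  with le[OF False] show ?thesis by (intro antisym)
qed

text \<open>A decomposition of small total cost has small \<open>x - w\<close> and, as \<open>\<eta> > 0\<close>, small \<open>w\<close>; this bounds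
\<open>x\<close>. Once \<open>x = 0\<close>, the exact value on the second factor applies.\<close>

lemma amalgam_norm_definite: "N (x, y) = 0 \<longleftrightarrow> x = 0 \<and> y = 0"
proof
  assume 0: "N (x, y) = 0"
  have "norm x \<le> (1 + inverse \<eta>) * (norm (x - w) + norm (y + f w) + \<eta> * norm w)" if "w \<in> X" for w
  proof -
    have "norm x \<le> norm (x - w) + norm w" by (metis add.commute norm_triangle_sub)
    moreover have "0 \<le> inverse \<eta> * (norm (x - w) + norm (y + f w))" "0 \<le> \<eta> * norm w"
      using \<eta> by simp_all
    moreover have "inverse \<eta> * (\<eta> * norm w) = norm w" using \<eta> by simp
    ultimately show ?thesis using norm_ge_zero[of "y + f w"]
      unfolding distrib_right distrib_left mult_1_left by linarith
  qed
  then have "norm x / (1 + inverse \<eta>) \<le> N (x, y)"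
    using \<eta> by (intro amalgam_norm_ge[OF X_nonempty]) (simp add: pos_divide_le_eq mult.commute add_pos_pos)
  then have x: "x = 0"
    using 0 \<eta> by (simp add: divide_le_0_iff add_pos_pos) (smt (verit) inverse_positive_iff_positive)
  then show "x = 0 \<and> y = 0" using 0 amalgam_norm_right[of y] by simp
qed (simp add: amalgam_norm_zero)

lemma norm_on_amalgam_norm: "norm_on P.scale Z N"
  unfolding norm_on_def
  using amalgam_norm_triangle amalgam_norm_scale amalgam_norm_definite \<eta>
  by (auto simp: P.scale_def zero_prod_def intro!: amalgam_norm_ge[OF X_nonempty])

end

text \<open>An approximate isometry into \<open>Y\<close> has an approximate left inverse that is as isometric as desired
and misses the identity by hardly more than \<open>\<eta>\<close>. Extend the isometry \<open>(x, 0) \<mapsto> x\<close> to the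
amalgam of \<open>X\<close> and \<open>Y\<close> and restrict the extension to \<open>Y\<close>; the distance from \<open>g (f x)\<close> to \<open>x\<close> is
the norm of the image of \<open>(x, - f x)\<close>.\<close>

lemma gurarii_approx_inverse:
  fixes sE :: "'k::real_or_complex \<Rightarrow> 'e::banach \<Rightarrow> 'e" and sF :: "'k \<Rightarrow> 'f::banach \<Rightarrow> 'f"
  assumes G: "gurarii_space sE" and F: "banach_over sF"
    and fdX: "fin_dim_subspace sE X" and fdY: "fin_dim_subspace sF Y" and fXY: "f ` X \<subseteq> Y"
    and f: "approx_isometry sE sF X norm norm \<eta> f" and \<eta>: "0 < \<eta>" and \<delta>: "0 < \<delta>"
  obtains g where "approx_isometry sF sE Y norm norm \<delta> g"
    "\<And>x. x \<in> X \<Longrightarrow> norm (g (f x) - x) \<le> (1 + \<delta>) * \<eta> * norm x"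
proof -
  have sX: "module.subspace sE X" and sY: "module.subspace sF Y"
    using fdX fdY by (auto simp: fin_dim_subspace_def)
  interpret amalgam sE sF X f \<eta>
    using G by (intro amalgam.intro F sX f \<eta>) (simp add: gurarii_space_def)
  have Z: "fin_dim_subspace P.scale (X \<times> Y)"
    by (rule fin_dim_Times[OF P.vector_space_pair_axioms fdX fdY])
  have fst: "isometry_op P.scale sE (X \<times> {0}) N norm fst"
    by (auto simp: isometry_op_def linear_op_on_def P.scale_def amalgam_norm_left)
  have sub: "P.p.subspace (X \<times> {0})" "X \<times> {0} \<subseteq> X \<times> Y"
    using P.subspace_Times[OF sX P.vs2.subspace_single_0] P.vs2.subspace_0[OF sY] by auto
  obtain h where h: "approx_isometry P.scale sE (X \<times> Y) N norm \<delta> h"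
      and h_fst: "\<And>z. z \<in> X \<times> {0} \<Longrightarrow> h z = fst z"
    using gurarii_approx_isometry_extension[OF G P.p.vector_space_axioms Z norm_on_amalgam_norm
      sub fst \<delta>] by blast
  note h_lin = approx_isometryD(1)[OF h]
  have 0: "0 \<in> X" "0 \<in> Y" using P.vs1.subspace_0[OF sX] P.vs2.subspace_0[OF sY] by auto
  show ?thesis
  proof (rule that[of "\<lambda>y. h (0, y)"])
    have "h (0, y + y') = h (0, y) + h (0, y')" if "y \<in> Y" "y' \<in> Y" for y y'
      using linear_op_on_add[OF h_lin, of "(0, y)" "(0, y')"] that 0 by simp
    moreover have "h (0, sF c y) = sE c (h (0, y))" if "y \<in> Y" for c y
      using linear_op_on_scale[OF h_lin, of "(0, y)" c] that 0 by (simp add: P.scale_def)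
    moreover have "norm y \<le> (1 + \<delta>) * norm (h (0, y)) \<and> norm (h (0, y)) \<le> (1 + \<delta>) * norm y"
      if "y \<in> Y" for y
      using approx_isometryD(2,3)[OF h, of "(0, y)"] that 0 by (simp add: amalgam_norm_right)
    ultimately show "approx_isometry sF sE Y norm norm \<delta> (\<lambda>y. h (0, y))"
      by (simp add: approx_isometry_def linear_op_on_def)
    fix x assume x: "x \<in> X"
    have mem: "(x, - f x) \<in> X \<times> Y" "(0, f x) \<in> X \<times> Y"
      using x 0 fXY P.vs2.subspace_neg[OF sY] by auto
    have "h (x, - f x) + h (0, f x) = h (x, 0)"
      using linear_op_on_add[OF h_lin mem] by simp
    then have "h (0, f x) - x = - h (x, - f x)"
      using h_fst[of "(x, 0)"] x by (simp add: algebra_simps)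
    then have "norm (h (0, f x) - x) = norm (h (x, - f x))" by simp
    also have "\<dots> \<le> (1 + \<delta>) * N (x, - f x)"
      by (rule approx_isometryD(3)[OF h mem(1)])
    also have "\<dots> \<le> (1 + \<delta>) * (\<eta> * norm x)"
      using \<delta> amalgam_norm_graph[OF x] by (intro mult_left_mono) auto
    finally show "norm (h (0, f x) - x) \<le> (1 + \<delta>) * \<eta> * norm x"
      by (simp add: mult.assoc)
  qed
qed

section \<open>One step back and forth\<close>

lemma fin_dim_cover_image:
  assumes "vector_space s" "vector_space t" "fin_dim_subspace s V" "linear_op_on s t V f" "finite B"
  obtains W where "fin_dim_subspace t W" "f ` V \<subseteq> W" "B \<subseteq> W"
proof -
  interpret t: vector_space t by fact
  obtain A where A: "finite A" "module.span s A = V" and V: "module.subspace s V"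
    using assms(3) by (auto simp: fin_dim_subspace_def)
  have "f ` V = t.span (f ` A)"
    by (rule linear_image_span[OF assms(1,2,4) V A(2)])
  then show ?thesis
    using A(1) assms(5) t.span_mono[of "f ` A" "f ` A \<union> B"] t.span_superset[of "f ` A \<union> B"]
    by (intro that[of "t.span (f ` A \<union> B)"] fin_dim_subspaceI[OF assms(2)]) auto
qed

lemma approx_isometry_mono:
  assumes "approx_isometry s t V N norm \<delta> f" "\<delta> \<le> \<epsilon>" "\<And>x. x \<in> V \<Longrightarrow> 0 \<le> N x"
  shows "approx_isometry s t V N norm \<epsilon> f"
proof -
  have "(1 + \<delta>) * a \<le> (1 + \<epsilon>) * a" if "0 \<le> a" for a
    using assms(2) that by (intro mult_right_mono) auto
  then show ?thesis
    using assms(1,3) unfolding approx_isometry_def by (meson norm_ge_zero order_trans)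
qed

text \<open>First an approximate inverse \<open>g\<close> of \<open>f\<close> is taken on a space \<open>Y\<close> containing \<open>B\<close>, then an approximate
inverse \<open>f'\<close> of \<open>g\<close> on a space \<open>X'\<close> containing \<open>X\<close> and \<open>A\<close>. The quality \<open>\<delta>\<close> of both is free,
so \<open>f'\<close> improves on \<open>f\<close> at a cost that is governed by \<open>\<eta>\<close>, and each \<open>b\<close> in \<open>B\<close> is almost attained,
namely at \<open>g b\<close>. The map \<open>g\<close> can be forgotten afterwards.\<close>

lemma back_and_forth_step:
  fixes sE :: "'k::real_or_complex \<Rightarrow> 'e::banach \<Rightarrow> 'e" and sF :: "'k \<Rightarrow> 'f::banach \<Rightarrow> 'f"
  assumes GE: "gurarii_space sE" and GF: "gurarii_space sF"
    and X: "fin_dim_subspace sE X" and f: "approx_isometry sE sF X norm norm \<eta> f"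
    and \<eta>: "0 < \<eta>" and \<kappa>: "0 < \<kappa>" and A: "finite A" and B: "finite B"
  obtains X' f' where "fin_dim_subspace sE X'" "X \<subseteq> X'" "A \<subseteq> X'"
    "approx_isometry sE sF X' norm norm \<kappa> f'"
    "\<And>x. x \<in> X \<Longrightarrow> norm (f' x - f x) \<le> (\<eta> + \<kappa>) * norm x"
    "\<And>b. b \<in> B \<Longrightarrow> \<exists>x\<in>X'. norm x \<le> 2 * norm b \<and> norm (f' x - b) \<le> \<kappa> * norm b"
proof -
  interpret E: banach_over sE using GE by (simp add: gurarii_space_def)
  interpret F: banach_over sF using GF by (simp add: gurarii_space_def)
  have E: "banach_over sE" and F: "banach_over sF" by unfold_locales
  \<comment> \<open>Chosen so that the error computed below,
    \<open>\<eta> + \<delta> * ((2 + \<delta>) * \<eta> + (1 + \<delta>) * (1 + \<eta>))\<close>, is at most \<open>\<eta> + \<kappa>\<close>.\<close>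
  define \<delta> where "\<delta> = min 1 (\<kappa> / (5 * \<eta> + 2))"
  have "0 < 5 * \<eta> + 2" using \<eta> by simp
  then have \<delta>: "0 < \<delta>" "\<delta> \<le> 1" "\<delta> * (5 * \<eta> + 2) \<le> \<kappa>"
    using \<kappa> mult_right_mono[of \<delta> "\<kappa> / (5 * \<eta> + 2)" "5 * \<eta> + 2"] by (auto simp: \<delta>_def)
  have "\<delta> * 2 \<le> \<delta> * (5 * \<eta> + 2)" using \<delta>(1) \<eta> by (intro mult_left_mono) auto
  then have \<delta>\<kappa>: "2 * \<delta> \<le> \<kappa>" using \<delta>(3) by linarith
  obtain Y where Y: "fin_dim_subspace sF Y" "f ` X \<subseteq> Y" "B \<subseteq> Y"
    using fin_dim_cover_image[OF E.vector_space_axioms F.vector_space_axioms X approx_isometryD(1)[OF f] B] .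
  obtain g where g: "approx_isometry sF sE Y norm norm \<delta> g"
      and gf: "\<And>x. x \<in> X \<Longrightarrow> norm (g (f x) - x) \<le> (1 + \<delta>) * \<eta> * norm x"
    using gurarii_approx_inverse[OF GE F X Y(1,2) f \<eta> \<delta>(1)] by blast
  obtain A0 where A0: "finite A0" "E.span A0 = X" using X by (auto simp: fin_dim_subspace_def)
  obtain X' where X': "fin_dim_subspace sE X'" "g ` Y \<subseteq> X'" "A \<union> A0 \<subseteq> X'"
    using fin_dim_cover_image[OF F.vector_space_axioms E.vector_space_axioms Y(1)
        approx_isometryD(1)[OF g], of "A \<union> A0"] A A0(1) by blast
  have sX': "E.subspace X'" using X'(1) by (simp add: fin_dim_subspace_def)
  have XX': "X \<subseteq> X'" using E.span_minimal[OF _ sX', of A0] X'(3) A0(2) by simp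
  obtain f' where f': "approx_isometry sE sF X' norm norm \<delta> f'"
      and fg: "\<And>y. y \<in> Y \<Longrightarrow> norm (f' (g y) - y) \<le> (1 + \<delta>) * \<delta> * norm y"
    using gurarii_approx_inverse[OF GF E Y(1) X'(1,2) g \<delta>(1) \<delta>(1)] by blast
  have d2: "(1 + \<delta>) * \<delta> * a \<le> 2 * \<delta> * a" if "0 \<le> a" for a
    using \<delta> that by (intro mult_right_mono) auto
  show ?thesis
  proof (rule that[OF X'(1) XX'])
    show "A \<subseteq> X'" using X'(3) by simp
    show "approx_isometry sE sF X' norm norm \<kappa> f'"
      using \<delta>(1) \<delta>\<kappa> by (intro approx_isometry_mono[OF f']) auto
  next
    fix x assume x: "x \<in> X"
    have mem: "x \<in> X'" "f x \<in> Y" "g (f x) \<in> X'" using x XX' X'(2) Y(2) by blast+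
    have 1: "norm (f' (g (f x)) - f' x) \<le> (1 + \<delta>) * ((1 + \<delta>) * \<eta> * norm x)"
    proof -
      have "f' (g (f x)) - f' x = f' (g (f x) - x)"
        by (rule linear_op_on_diff[OF E.vector_space_axioms F.vector_space_axioms
              approx_isometryD(1)[OF f'] sX' mem(3,1), symmetric])
      then have "norm (f' (g (f x)) - f' x) \<le> (1 + \<delta>) * norm (g (f x) - x)"
        using approx_isometryD(3)[OF f' E.subspace_diff[OF sX' mem(3,1)]] by simp
      also have "\<dots> \<le> (1 + \<delta>) * ((1 + \<delta>) * \<eta> * norm x)"
        using gf[OF x] \<delta>(1) by (intro mult_left_mono) auto
      finally show ?thesis .
    qed
    have 2: "norm (f' (g (f x)) - f x) \<le> (1 + \<delta>) * \<delta> * ((1 + \<eta>) * norm x)"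
      using \<delta>(1) by (intro order_trans[OF fg[OF mem(2)]] mult_left_mono approx_isometryD(3)[OF f x]) simp
    have "norm (f' x - f x) \<le> norm (f' (g (f x)) - f' x) + norm (f' (g (f x)) - f x)"
      using norm_triangle_ineq[of "f' x - f' (g (f x))" "f' (g (f x)) - f x"]
      by (simp add: norm_minus_commute)
    also have "\<dots> \<le> (1 + \<delta>) * ((1 + \<delta>) * \<eta> * norm x) + (1 + \<delta>) * \<delta> * ((1 + \<eta>) * norm x)"
      using 1 2 by (rule add_mono)
    also have "\<dots> = (\<eta> + \<delta> * ((2 + \<delta>) * \<eta> + (1 + \<delta>) * (1 + \<eta>))) * norm x"
      by (simp add: algebra_simps)
    also have "\<dots> \<le> (\<eta> + \<kappa>) * norm x"
    proof (intro mult_right_mono add_left_mono)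
      have "(2 + \<delta>) * \<eta> + (1 + \<delta>) * (1 + \<eta>) \<le> 3 * \<eta> + 2 * (1 + \<eta>)"
        using \<delta> \<eta> by (intro add_mono mult_right_mono) auto
      then have "\<delta> * ((2 + \<delta>) * \<eta> + (1 + \<delta>) * (1 + \<eta>)) \<le> \<delta> * (5 * \<eta> + 2)"
        using \<delta>(1) by (intro mult_left_mono) auto
      with \<delta>(3) show "\<delta> * ((2 + \<delta>) * \<eta> + (1 + \<delta>) * (1 + \<eta>)) \<le> \<kappa>" by linarith
    qed simp
    finally show "norm (f' x - f x) \<le> (\<eta> + \<kappa>) * norm x" .
  next
    fix b assume b: "b \<in> B"
    then have bY: "b \<in> Y" using Y by auto
    have "norm (g b) \<le> 2 * norm b"
      using approx_isometryD(3)[OF g bY] mult_right_mono[of "1 + \<delta>" 2 "norm b"] \<delta>(2) by simp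
    moreover have "norm (f' (g b) - b) \<le> \<kappa> * norm b"
      using fg[OF bY] d2[of "norm b"] mult_right_mono[OF \<delta>\<kappa>, of "norm b"] by simp
    ultimately show "\<exists>x\<in>X'. norm x \<le> 2 * norm b \<and> norm (f' x - b) \<le> \<kappa> * norm b"
      using X'(2) bY by blast
  qed
qed

text \<open>The strict inequalities leave room: on the compact unit sphere \<open>norm (f x)\<close> attains its bounds. It is
this room that makes the distance in the theorem strictly smaller than \<open>\<epsilon>\<close>.\<close>

lemma eps_isometry_imp_approx_isometry:
  fixes sE :: "'k::real_or_complex \<Rightarrow> 'e::banach \<Rightarrow> 'e" and sF :: "'k \<Rightarrow> 'f::banach \<Rightarrow> 'f"
  assumes E: "banach_over sE" and F: "banach_over sF" and fd: "fin_dim_subspace sE X"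
    and \<epsilon>: "0 < \<epsilon>" and f: "eps_isometry sE sF X norm norm \<epsilon> f"
  obtains \<eta> where "0 < \<eta>" "\<eta> < \<epsilon>" "approx_isometry sE sF X norm norm \<eta> f"
proof -
  interpret E: banach_over sE by fact
  interpret F: banach_over sF by fact
  have X: "E.subspace X" using fd by (simp add: fin_dim_subspace_def)
  have lin: "linear_op_on sE sF X f" using f by (simp add: eps_isometry_def)
  note [simp] = linear_op_on_add[OF lin] linear_op_on_scale[OF lin]
  have f0: "f 0 = 0" by (rule linear_op_on_zero[OF E.vector_space_axioms F.vector_space_axioms lin X])
  have "\<exists>C. \<forall>x\<in>X. norm (f x) \<le> C * norm x"
    by (rule fin_dim_seminorm_bounded[OF E.vector_space_axioms fd norm_on_norm[OF E]])
       (simp_all add: norm_triangle_ineq F.norm_scale)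
  then obtain C where C: "\<forall>x\<in>X. norm (f x) \<le> C * norm x" ..
  define S where "S = {x \<in> X. norm x = 1}"
  have lip: "C-lipschitz_on X f" if C0: "0 \<le> C"
    using C0 C by (intro lipschitz_onI)
      (auto simp: dist_norm E.subspace_diff[OF X]
        simp flip: linear_op_on_diff[OF E.vector_space_axioms F.vector_space_axioms lin X])
  have C0: "0 \<le> C" if ne: "S \<noteq> {}"
  proof -
    obtain y where "y \<in> X" "norm y = 1" using ne by (auto simp: S_def)
    then have "norm (f y) \<le> C" using C by force
    then show ?thesis by (rule order_trans[OF norm_ge_zero])
  qed
  have cont: "continuous_on S (\<lambda>x. norm (f x))" if "S \<noteq> {}"
    using lipschitz_on_continuous_on[OF lip[OF C0[OF that]]]
    by (rule continuous_on_norm[OF continuous_on_subset]) (auto simp: S_def)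
  have "\<exists>\<eta>>0. \<eta> < \<epsilon> \<and> (\<forall>y\<in>S. 1 \<le> (1 + \<eta>) * norm (f y) \<and> norm (f y) \<le> 1 + \<eta>)"
  proof (cases "S = {}")
    case True
    \<comment> \<open>The trivial space: any \<open>\<eta>\<close> between \<open>0\<close> and \<open>\<epsilon>\<close> will do.\<close>
    then show ?thesis using \<epsilon> by (intro exI[of _ "\<epsilon> / 2"]) auto
  next
    case False
    have cS: "compact S" unfolding S_def by (rule compact_unit_sphere[OF E fd])
    obtain u where u: "u \<in> S" "\<forall>y\<in>S. norm (f y) \<le> norm (f u)"
      using continuous_attains_sup[OF cS False cont[OF False]] by blast
    obtain v where v: "v \<in> S" "\<forall>y\<in>S. norm (f v) \<le> norm (f y)"
      using continuous_attains_inf[OF cS False cont[OF False]] by blast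
    have bu: "norm (f u) < 1 + \<epsilon>" and bv: "inverse (1 + \<epsilon>) < norm (f v)"
      using u(1) v(1) f by (auto simp: eps_isometry_def S_def)
    have pos: "0 < norm (f v)" using bv \<epsilon> by (smt (verit) inverse_positive_iff_positive)
    have bv': "inverse (norm (f v)) < 1 + \<epsilon>" using bv pos \<epsilon>
      by (metis inverse_inverse_eq inverse_less_iff_less add_pos_pos zero_less_one positive_imp_inverse_positive)
    \<comment> \<open>The entry \<open>\<epsilon> / 2\<close> only keeps \<open>\<eta>\<close> positive.\<close>
    define \<eta> where "\<eta> = max (\<epsilon> / 2) (max (norm (f u) - 1) (inverse (norm (f v)) - 1))"
    have \<eta>: "0 < \<eta>" "\<eta> < \<epsilon>" "norm (f u) \<le> 1 + \<eta>" "inverse (norm (f v)) \<le> 1 + \<eta>"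
      using \<epsilon> bu bv' by (auto simp: \<eta>_def)
    have "1 \<le> (1 + \<eta>) * norm (f y)" if "y \<in> S" for y
    proof -
      have "1 = inverse (norm (f v)) * norm (f v)" using pos by simp
      also have "\<dots> \<le> (1 + \<eta>) * norm (f y)"
        using \<eta> v(2) that by (intro mult_mono) auto
      finally show ?thesis .
    qed
    with \<eta> u(2) show ?thesis by (intro exI[of _ \<eta>]) force
  qed
  then obtain \<eta> where \<eta>: "0 < \<eta>" "\<eta> < \<epsilon>"
      "\<And>y. y \<in> S \<Longrightarrow> 1 \<le> (1 + \<eta>) * norm (f y)" "\<And>y. y \<in> S \<Longrightarrow> norm (f y) \<le> 1 + \<eta>"
    by blast
  have "norm x \<le> (1 + \<eta>) * norm (f x) \<and> norm (f x) \<le> (1 + \<eta>) * norm x" if x: "x \<in> X" for x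
  proof (cases "x = 0")
    case True
    then show ?thesis by (simp add: f0)
  next
    case False
    define y where "y = sE (of_real (inverse (norm x))) x"
    have "y \<in> S"
      using False by (simp add: y_def S_def E.subspace_scale[OF X x] E.norm_scale norm_inverse del: of_real_inverse)
    moreover have "norm (f x) = norm x * norm (f y)"
      using x False by (simp add: y_def F.norm_scale norm_inverse del: of_real_inverse)
    ultimately show ?thesis
      using mult_left_mono[OF \<eta>(3)[of y], of "norm x"] mult_left_mono[OF \<eta>(4)[of y], of "norm x"]
      by (simp add: ac_simps)
  qed
  with lin \<eta>(1,2) show ?thesis by (intro that[of \<eta>]) (auto simp: approx_isometry_def)
qed

section \<open>The limit isometry\<close>

text \<open>Each \<open>f n\<close> is linear and bounded on \<open>X n\<close> only, so the limit is taken along approximants: \<open>p n x\<close> in \<open>X n\<close>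
converges to \<open>x\<close>, and \<open>h x\<close> is the limit of \<open>f n (p n x)\<close>. This defines \<open>h\<close> on the whole space at
once, without extending from the dense union of the \<open>X n\<close>. The maps are uniformly Lipschitz, so the
limit does not depend on the approximants, which gives linearity. Writing the successive errors
as differences of \<open>\<tau>\<close> lets them telescope.\<close>

lemma limit_of_approx_isometries:
  fixes sE :: "'k::real_or_complex \<Rightarrow> 'e::banach \<Rightarrow> 'e" and sF :: "'k \<Rightarrow> 'f::banach \<Rightarrow> 'f"
    and X :: "nat \<Rightarrow> 'e set" and f :: "nat \<Rightarrow> 'e \<Rightarrow> 'f"
  assumes E: "banach_over sE" and F: "banach_over sF"
    and X: "\<And>n. module.subspace sE (X n)" and X_mono: "\<And>n. X n \<subseteq> X (Suc n)"
    and dense: "\<And>x r. 0 < r \<Longrightarrow> \<exists>n. \<exists>z\<in>X n. norm (z - x) < r"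
    and f: "\<And>n. approx_isometry sE sF (X n) norm norm (e n) (f n)"
    and e: "e \<longlonglongrightarrow> 0" and e_nonneg: "\<And>n. 0 \<le> e n"
    and \<tau>: "\<tau> \<longlonglongrightarrow> 0" and \<tau>_nonneg: "\<And>n. 0 \<le> \<tau> n"
    and f_step: "\<And>n x. x \<in> X n \<Longrightarrow> norm (f (Suc n) x - f n x) \<le> (\<tau> n - \<tau> (Suc n)) * norm x"
  obtains h where "isometry_op sE sF UNIV norm norm h"
    "\<And>n x. x \<in> X n \<Longrightarrow> norm (h x - f n x) \<le> \<tau> n * norm x"
proof -
  interpret E: banach_over sE by fact
  interpret F: banach_over sF by fact
  note lin = approx_isometryD(1)[OF f]
  note f_diff = linear_op_on_diff[OF E.vector_space_axioms F.vector_space_axioms lin X]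
  have X_le: "X n \<subseteq> X m" if "n \<le> m" for n m
    using X_mono that by (rule lift_Suc_mono_le)
  obtain C where C: "\<And>n. 1 + e n \<le> C"
  proof -
    obtain K where "\<And>n. norm (e n) \<le> K"
      using convergent_imp_Bseq[OF convergentI[OF e]] by (auto simp: Bseq_def)
    then have "1 + e n \<le> 1 + K" for n using abs_ge_self[of "e n"] order_trans by fastforce
    then show ?thesis by (rule that)
  qed
  have C0: "0 < C" using C[of 0] e_nonneg[of 0] by linarith
  have f_upper: "norm (f n x) \<le> C * norm x" if "x \<in> X n" for n x
    using approx_isometryD(3)[OF f that] mult_right_mono[OF C norm_ge_zero] by (rule order_trans)
  have f_telescope: "norm (f m x - f n x) \<le> (\<tau> n - \<tau> m) * norm x" if "n \<le> m" "x \<in> X n" for n m x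
    using that(1)
  proof (induction rule: dec_induct)
    case base
    show ?case by simp
  next
    case (step k)
    have "x \<in> X k" using X_le[OF step(1)] that(2) by auto
    have "norm (f (Suc k) x - f n x) \<le> norm (f (Suc k) x - f k x) + norm (f k x - f n x)"
      using norm_triangle_ineq[of "f (Suc k) x - f k x" "f k x - f n x"] by simp
    also have "\<dots> \<le> (\<tau> k - \<tau> (Suc k)) * norm x + (\<tau> n - \<tau> k) * norm x"
      by (intro add_mono f_step step.IH \<open>x \<in> X k\<close>)
    finally show ?case by (simp add: algebra_simps)
  qed
  \<comment> \<open>This estimate drives both the Cauchy property and the final error bound.\<close>
  have f_close: "norm (f m w - f n z) \<le> C * norm (w - z) + \<tau> n * norm z"
    if "n \<le> m" "z \<in> X n" "w \<in> X m" for n m z w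
  proof -
    have z: "z \<in> X m" using X_le that by blast
    have "norm (f m w - f n z) \<le> norm (f m (w - z)) + norm (f m z - f n z)"
      using norm_triangle_ineq[of "f m w - f m z" "f m z - f n z"] by (simp add: f_diff that z)
    also have "\<dots> \<le> C * norm (w - z) + (\<tau> n - \<tau> m) * norm z"
      by (intro add_mono f_upper f_telescope that E.subspace_diff[OF X] z)
    also have "\<dots> \<le> C * norm (w - z) + \<tau> n * norm z"
      using \<tau>_nonneg[of m] by (intro add_left_mono mult_right_mono) auto
    finally show ?thesis .
  qed
  have "\<exists>z. z \<in> X n \<and> dist x z < infdist x (X n) + inverse (Suc n)" for n x
  proof -
    have "X n \<noteq> {}" using E.subspace_0[OF X] by blast
    moreover from this have "(INF z\<in>X n. dist x z) < infdist x (X n) + inverse (Suc n)"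
      by (simp add: infdist_notempty)
    ultimately show ?thesis
      using cInf_lessD[of "dist x ` X n"] by blast
  qed
  then obtain p where p: "\<And>n x. p n x \<in> X n" "\<And>n x. dist x (p n x) < infdist x (X n) + inverse (Suc n)"
    by metis
  have p_lim: "(\<lambda>n. p n x) \<longlonglongrightarrow> x" for x
  proof (rule metric_LIMSEQ_I)
    fix r :: real assume r: "0 < r"
    obtain k z where z: "z \<in> X k" "norm (z - x) < r / 2" using dense[of "r / 2" x] r by auto
    obtain l where l: "inverse (Suc l) < r / 2" using reals_Archimedean[of "r / 2"] r by auto
    have "dist (p n x) x < r" if "max k l \<le> n" for n
    proof -
      have "infdist x (X n) \<le> dist x z" using X_le[of k n] z that by (intro infdist_le) auto
      also have "\<dots> < r / 2" using z by (simp add: dist_norm norm_minus_commute)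
      finally have "infdist x (X n) < r / 2" .
      moreover have "inverse (real (Suc n)) \<le> inverse (real (Suc l))"
        using that by (intro le_imp_inverse_le) auto
      ultimately have "dist x (p n x) < r" using p(2)[of x n] l by linarith
      then show ?thesis by (simp add: dist_commute)
    qed
    then show "\<exists>k. \<forall>n\<ge>k. dist (p n x) x < r" by blast
  qed
  have "Cauchy (\<lambda>n. f n (p n x))" for x
    unfolding Cauchy_altdef2
  proof (intro allI impI)
    fix r :: real assume r: "0 < r"
    obtain K where K: "0 < K" "\<And>n. norm (p n x) \<le> K"
      using convergent_imp_Bseq[OF convergentI[OF p_lim[of x]]] by (auto simp: Bseq_def)
    obtain k where k: "\<forall>m\<ge>k. dist (p m x) x < r / (4 * C)"
      using metric_LIMSEQ_D[OF p_lim[of x], of "r / (4 * C)"] r C0 by auto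
    obtain l where l: "\<forall>n\<ge>l. norm (\<tau> n - 0) < r / (2 * K)"
      using LIMSEQ_D[OF \<tau>, of "r / (2 * K)"] r K(1) by auto
    define n where "n = max k l"
    have "dist (f m (p m x)) (f n (p n x)) < r" if "n \<le> m" for m
    proof -
      have "norm (p m x - p n x) \<le> dist (p m x) x + dist (p n x) x"
        by (metis dist_norm dist_triangle2)
      also have "\<dots> < r / (4 * C) + r / (4 * C)"
        using k that by (intro add_strict_mono) (auto simp: n_def)
      finally have "C * norm (p m x - p n x) < r / 2" using C0 by (simp add: field_simps)
      moreover have "\<tau> n < r / (2 * K)" using l[rule_format, of n] by (simp add: n_def)
      then have "\<tau> n * norm (p n x) \<le> r / 2"
        using K mult_mono[of "\<tau> n" "r / (2 * K)" "norm (p n x)" K] r by (simp add: field_simps)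
      ultimately show ?thesis
        using f_close[OF that p(1) p(1)] by (simp add: dist_norm) (smt (verit))
    qed
    then show "\<exists>n. \<forall>m\<ge>n. dist (f m (p m x)) (f n (p n x)) < r" by blast
  qed
  then have "\<exists>y. (\<lambda>n. f n (p n x)) \<longlonglongrightarrow> y" for x
    by (simp add: Cauchy_convergent_iff convergent_def)
  then obtain h where h: "\<And>x. (\<lambda>n. f n (p n x)) \<longlonglongrightarrow> h x" by metis
  \<comment> \<open>Independence of the approximating sequence.\<close>
  have h_eqI: "h x = y" if "\<And>n. z n \<in> X n" "z \<longlonglongrightarrow> x" "(\<lambda>n. f n (z n)) \<longlonglongrightarrow> y" for x y z
  proof -
    have "(\<lambda>n. C * norm (p n x - z n)) \<longlonglongrightarrow> C * norm (x - x)"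
      by (intro tendsto_intros p_lim that)
    then have "(\<lambda>n. C * norm (p n x - z n)) \<longlonglongrightarrow> 0" by simp
    then have "(\<lambda>n. f n (p n x) - f n (z n)) \<longlonglongrightarrow> 0"
      by (rule Lim_null_comparison[rotated])
         (auto simp: f_upper E.subspace_diff[OF X] p that simp flip: f_diff)
    from tendsto_add[OF this that(3)] have "(\<lambda>n. f n (p n x)) \<longlonglongrightarrow> y" by simp
    with h show ?thesis by (rule LIMSEQ_unique)
  qed
  have sF_tendsto: "(\<lambda>n. sF c (y n)) \<longlonglongrightarrow> sF c l" if "y \<longlonglongrightarrow> l" for c and y :: "nat \<Rightarrow> 'f" and l
  proof -
    have "(\<lambda>n. norm c * norm (y n - l)) \<longlonglongrightarrow> norm c * norm (l - l)"
      by (intro tendsto_intros that)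
    then show ?thesis
      by (subst LIM_zero_iff[symmetric], subst tendsto_norm_zero_iff[symmetric])
         (simp add: F.norm_scale flip: F.scale_right_diff_distrib)
  qed
  have sE_tendsto: "(\<lambda>n. sE c (y n)) \<longlonglongrightarrow> sE c l" if "y \<longlonglongrightarrow> l" for c and y :: "nat \<Rightarrow> 'e" and l
  proof -
    have "(\<lambda>n. norm c * norm (y n - l)) \<longlonglongrightarrow> norm c * norm (l - l)"
      by (intro tendsto_intros that)
    then show ?thesis
      by (subst LIM_zero_iff[symmetric], subst tendsto_norm_zero_iff[symmetric])
         (simp add: E.norm_scale flip: E.scale_right_diff_distrib)
  qed
  have "h (x + y) = h x + h y" for x y
    by (rule h_eqI[of "\<lambda>n. p n x + p n y"])
       (auto intro!: tendsto_add p_lim h E.subspace_add[OF X] p simp: linear_op_on_add[OF lin] p)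
  moreover have "h (sE c x) = sF c (h x)" for c x
    by (rule h_eqI[of "\<lambda>n. sE c (p n x)"])
       (auto intro!: sE_tendsto sF_tendsto p_lim h E.subspace_scale[OF X] p simp: linear_op_on_scale[OF lin] p)
  moreover have "norm (h x) = norm x" for x
  proof (rule antisym)
    have "(\<lambda>n. (1 + e n) * norm (p n x)) \<longlonglongrightarrow> (1 + 0) * norm x"
      by (intro tendsto_intros p_lim e)
    from LIMSEQ_le[OF tendsto_norm[OF h] this] show "norm (h x) \<le> norm x"
      using approx_isometryD(3)[OF f p(1)] by auto
    have "(\<lambda>n. (1 + e n) * norm (f n (p n x))) \<longlonglongrightarrow> (1 + 0) * norm (h x)"
      by (intro tendsto_intros h e)
    from LIMSEQ_le[OF tendsto_norm[OF p_lim] this] show "norm x \<le> norm (h x)"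
      using approx_isometryD(2)[OF f p(1)] by auto
  qed
  ultimately have iso: "isometry_op sE sF UNIV norm norm h"
    by (simp add: isometry_op_def linear_op_on_def)
  have "norm (h x - f n x) \<le> \<tau> n * norm x" if x: "x \<in> X n" for n x
  proof -
    have l: "(\<lambda>m. norm (f m (p m x) - f n x)) \<longlonglongrightarrow> norm (h x - f n x)"
      by (intro tendsto_intros h)
    have "(\<lambda>m. C * norm (p m x - x) + \<tau> n * norm x) \<longlonglongrightarrow> C * norm (x - x) + \<tau> n * norm x"
      by (intro tendsto_intros p_lim)
    from LIMSEQ_le[OF l this] show ?thesis
      using f_close[OF _ x p(1)] by auto
  qed
  with iso show ?thesis by (rule that)
qed

section \<open>Uniqueness of the Gurarii space\<close>

lemma separable_dense_sequence:
  assumes "separable_space (euclidean :: 'a::metric_space topology)"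
  obtains d :: "nat \<Rightarrow> 'a::metric_space" where "\<And>x r. 0 < r \<Longrightarrow> \<exists>k. dist (d k) x < r"
proof -
  obtain D :: "'a set" where D: "countable D" "closure D = UNIV"
    using assms by (auto simp: separable_space_def)
  then have "D \<noteq> {}" by auto
  then have "range (from_nat_into D) = D" using D(1) by (rule range_from_nat_into)
  moreover have "\<exists>y\<in>D. dist y x < r" if "0 < r" for x r
    using D(2) that closure_approachable[of x D] by auto
  ultimately show ?thesis
    by (intro that[of "from_nat_into D"]) (metis image_iff)
qed

text \<open>The range of an isometry on a complete space is complete, hence closed, so density gives
surjectivity.\<close>

lemma isometry_op_bij:
  fixes sE :: "'k::real_or_complex \<Rightarrow> 'e::banach \<Rightarrow> 'e" and sF :: "'k \<Rightarrow> 'f::banach \<Rightarrow> 'f"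
  assumes E: "banach_over sE" and F: "banach_over sF" and h: "isometry_op sE sF UNIV norm norm h"
    and dense: "\<And>y r. 0 < r \<Longrightarrow> \<exists>x. dist (h x) y < r"
  shows "bij h"
proof -
  interpret E: banach_over sE by fact
  interpret F: banach_over sF by fact
  have add: "h (x + y) = h x + h y" and scale: "h (sE c x) = sF c (h x)" and norm: "norm (h x) = norm x"
    for x y c using h by (auto simp: isometry_op_def linear_op_on_def)
  have bl: "bounded_linear h"
  proof (rule bounded_linear_intro[of _ 1])
    show "h (r *\<^sub>R x) = r *\<^sub>R h x" for r x
      using scale[of "of_real r" x] by (simp add: E.scale_of_real F.scale_of_real)
  qed (auto simp: add norm)
  have "inj h"
    using bl by (simp add: bounded_linear.linear linear_inj_iff_eq_0) (metis norm norm_eq_zero)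
  moreover have "complete (range h)"
    by (rule complete_isometric_image[of 1]) (auto simp: bl norm complete_UNIV)
  then have "closed (range h)" by (rule complete_imp_closed)
  moreover have "closure (range h) = UNIV"
    using dense by (auto simp: closure_approachable)
  ultimately show ?thesis by (simp add: bij_def)
qed

theorem theorem1p1:
  fixes sE :: "'k::real_or_complex \<Rightarrow> 'e::banach \<Rightarrow> 'e"
    and sF :: "'k \<Rightarrow> 'f::banach \<Rightarrow> 'f"
    and X :: "'e set" and f :: "'e \<Rightarrow> 'f" and \<epsilon> :: real
  assumes "gurarii_space sE" and "gurarii_space sF"
    and "0 < \<epsilon>"
    and "fin_dim_subspace sE X"
    and "eps_isometry sE sF X norm norm \<epsilon> f"
  shows "\<exists>h. bij h \<and> isometry_op sE sF UNIV norm norm h \<and>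
             op_norm X norm norm (\<lambda>x. h x - f x) < \<epsilon>"
proof -
  interpret E: banach_over sE using assms(1) by (simp add: gurarii_space_def)
  interpret F: banach_over sF using assms(2) by (simp add: gurarii_space_def)
  have E: "banach_over sE" and F: "banach_over sF" by unfold_locales
  obtain \<eta> where \<eta>: "0 < \<eta>" "\<eta> < \<epsilon>" "approx_isometry sE sF X norm norm \<eta> f"
    using eps_isometry_imp_approx_isometry[OF E F assms(4,3,5)] .
  obtain a :: "nat \<Rightarrow> 'e" where a: "\<And>x r. 0 < r \<Longrightarrow> \<exists>k. dist (a k) x < r"
    using assms(1) by (auto simp: gurarii_space_def intro: separable_dense_sequence)
  obtain b :: "nat \<Rightarrow> 'f" where b: "\<And>x r. 0 < r \<Longrightarrow> \<exists>k. dist (b k) x < r"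
    using assms(2) by (auto simp: gurarii_space_def intro: separable_dense_sequence)
  \<comment> \<open>Step \<open>n\<close> costs \<open>e n + e (Suc n)\<close>, and \<open>\<tau> n\<close> is the sum of all costs from step
    \<open>n\<close> on. In particular \<open>\<tau> 0 = \<eta> + 2 * \<theta>\<close>, which \<open>\<theta>\<close> keeps below \<open>\<epsilon>\<close>.\<close>
  define \<theta> where "\<theta> = (\<epsilon> - \<eta>) / 3"
  define e where "e n = (if n = 0 then \<eta> else \<theta> / 2 ^ n)" for n :: nat
  define \<tau> where "\<tau> n = (if n = 0 then \<eta> + 2 * \<theta> else 3 * \<theta> / 2 ^ n)" for n :: nat
  have \<theta>: "0 < \<theta>" using \<eta> by (simp add: \<theta>_def)
  have e_pos: "0 < e n" for n using \<eta> \<theta> by (simp add: e_def)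
  have \<tau>_nonneg: "0 \<le> \<tau> n" for n using \<eta> \<theta> by (simp add: \<tau>_def)
  have \<tau>_diff: "e n + e (Suc n) = \<tau> n - \<tau> (Suc n)" for n
    by (cases n) (auto simp: e_def \<tau>_def field_simps)
  have null: "(\<lambda>n. c / 2 ^ n) \<longlonglongrightarrow> 0" for c :: real
    using tendsto_mult_right_zero[OF LIMSEQ_realpow_zero[of "1 / 2"], of c]
    by (simp add: power_divide)
  have e_lim: "e \<longlonglongrightarrow> 0"
    by (rule Lim_transform_eventually[OF null[of \<theta>]])
       (rule eventually_sequentiallyI[of 1], simp add: e_def)
  have \<tau>_lim: "\<tau> \<longlonglongrightarrow> 0"
    by (rule Lim_transform_eventually[OF null[of "3 * \<theta>"]])
       (rule eventually_sequentiallyI[of 1], simp add: \<tau>_def)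
  let ?P = "\<lambda>n (V, g). fin_dim_subspace sE V \<and> approx_isometry sE sF V norm norm (e n) g \<and>
      (n = 0 \<longrightarrow> V = X \<and> g = f)"
  \<comment> \<open>Taking all of \<open>b 0, \<dots>, b n\<close> into step \<open>n\<close> makes every \<open>b k\<close> approximable
    with errors tending to \<open>0\<close>.\<close>
  let ?Q = "\<lambda>n (V, g) (V', g'). V \<subseteq> V' \<and> a ` {..n} \<subseteq> V' \<and>
      (\<forall>x\<in>V. norm (g' x - g x) \<le> (e n + e (Suc n)) * norm x) \<and>
      (\<forall>y\<in>b ` {..n}. \<exists>x\<in>V'. norm x \<le> 2 * norm y \<and> norm (g' x - y) \<le> e (Suc n) * norm y)"
  have "\<exists>S. \<forall>n. ?P n (S n) \<and> ?Q n (S n) (S (Suc n))"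
  proof (rule dependent_nat_choice)
    show "\<exists>S. ?P 0 S" using assms(4) \<eta> by (intro exI[of _ "(X, f)"]) (simp add: e_def)
    fix S n assume "?P n S"
    moreover obtain V g where S: "S = (V, g)" by (cases S)
    ultimately have Vg: "fin_dim_subspace sE V" "approx_isometry sE sF V norm norm (e n) g" by auto
    obtain V' g' where "fin_dim_subspace sE V'" "V \<subseteq> V'" "a ` {..n} \<subseteq> V'"
      "approx_isometry sE sF V' norm norm (e (Suc n)) g'"
      "\<And>x. x \<in> V \<Longrightarrow> norm (g' x - g x) \<le> (e n + e (Suc n)) * norm x"
      "\<And>y. y \<in> b ` {..n} \<Longrightarrow>
        \<exists>x\<in>V'. norm x \<le> 2 * norm y \<and> norm (g' x - y) \<le> e (Suc n) * norm y"
      by (rule back_and_forth_step[where \<kappa> = "e (Suc n)" and A = "a ` {..n}" and B = "b ` {..n}",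
            OF assms(1,2) Vg e_pos e_pos finite_imageI[OF finite_atMost]
              finite_imageI[OF finite_atMost]]) blast
    then have "?P (Suc n) (V', g')" "?Q n S (V', g')" unfolding S by simp_all
    then show "\<exists>S'. ?P (Suc n) S' \<and> ?Q n S S'" by blast
  qed
  then obtain S where S: "\<forall>n. ?P n (S n) \<and> ?Q n (S n) (S (Suc n))" ..
  define V where "V n = fst (S n)" for n
  define g where "g n = snd (S n)" for n
  have V: "fin_dim_subspace sE (V n)" and g: "approx_isometry sE sF (V n) norm norm (e n) (g n)"
    and V_mono: "V n \<subseteq> V (Suc n)" and aV: "a ` {..n} \<subseteq> V (Suc n)"
    and g_step: "\<And>x. x \<in> V n \<Longrightarrow> norm (g (Suc n) x - g n x) \<le> (e n + e (Suc n)) * norm x"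
    and bV: "\<And>y. y \<in> b ` {..n} \<Longrightarrow>
      \<exists>x\<in>V (Suc n). norm x \<le> 2 * norm y \<and> norm (g (Suc n) x - y) \<le> e (Suc n) * norm y" for n
    using S[THEN spec, of n] by (auto simp: V_def g_def case_prod_beta)
  have 0: "V 0 = X" "g 0 = f" using S[THEN spec, of 0] by (auto simp: V_def g_def case_prod_beta)
  have dense: "\<exists>n. \<exists>z\<in>V n. norm (z - x) < r" if r: "0 < r" for x r
  proof -
    obtain k where "dist (a k) x < r" using a[OF r] by blast
    then show ?thesis using aV[of k] by (intro exI[of _ "Suc k"] bexI[of _ "a k"]) (auto simp: dist_norm)
  qed
  obtain h where h: "isometry_op sE sF UNIV norm norm h"
      and hg: "\<And>n x. x \<in> V n \<Longrightarrow> norm (h x - g n x) \<le> \<tau> n * norm x"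
  proof (rule limit_of_approx_isometries[OF E F _ V_mono dense g e_lim _ \<tau>_lim \<tau>_nonneg])
    show "module.subspace sE (V n)" for n using V by (simp add: fin_dim_subspace_def)
    show "norm (g (Suc n) x - g n x) \<le> (\<tau> n - \<tau> (Suc n)) * norm x" if "x \<in> V n" for n x
      using g_step[OF that] by (simp add: \<tau>_diff)
  qed (use e_pos in \<open>auto intro: less_imp_le\<close>)
  have "bij h"
  proof (rule isometry_op_bij[OF E F h])
    fix y :: 'f and r :: real assume r: "0 < r"
    obtain k where k: "dist (b k) y < r / 2" using b[of "r / 2" y] r by auto
    \<comment> \<open>The bound for the distance from \<open>b k\<close> to \<open>h x\<close>, where \<open>x\<close> is the vector supplied at step \<open>n\<close>.\<close>
    have "(\<lambda>n. (2 * \<tau> (Suc n) + e (Suc n)) * norm (b k)) \<longlonglongrightarrow> (2 * 0 + 0) * norm (b k)"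
      by (intro tendsto_intros LIMSEQ_Suc \<tau>_lim e_lim)
    then have "eventually (\<lambda>n. (2 * \<tau> (Suc n) + e (Suc n)) * norm (b k) < r / 2) sequentially"
      using r by (intro order_tendstoD(2)[where y = "(2 * 0 + 0) * norm (b k)"]) auto
    with eventually_ge_at_top[of k]
    have "eventually (\<lambda>n. k \<le> n \<and> (2 * \<tau> (Suc n) + e (Suc n)) * norm (b k) < r / 2) sequentially"
      by (rule eventually_conj)
    then obtain n where n: "k \<le> n" "(2 * \<tau> (Suc n) + e (Suc n)) * norm (b k) < r / 2"
      using eventually_happens by force
    obtain x where x: "x \<in> V (Suc n)" "norm x \<le> 2 * norm (b k)"
        "norm (g (Suc n) x - b k) \<le> e (Suc n) * norm (b k)"
      using bV[of "b k" n] n(1) by auto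
    have "norm (h x - b k) \<le> norm (h x - g (Suc n) x) + norm (g (Suc n) x - b k)"
      using norm_triangle_ineq[of "h x - g (Suc n) x" "g (Suc n) x - b k"] by simp
    also have "\<dots> \<le> \<tau> (Suc n) * (2 * norm (b k)) + e (Suc n) * norm (b k)"
      using hg[OF x(1)] mult_left_mono[OF x(2) \<tau>_nonneg[of "Suc n"]] x(3) by linarith
    also have "\<dots> < r / 2" using n(2) by (simp add: algebra_simps)
    finally have "dist (h x) (b k) < r / 2" by (simp add: dist_norm)
    then have "dist (h x) y < r" using k dist_triangle_half_l[of "h x" "b k" r y]
      by (metis dist_commute dist_triangle_half_r)
    then show "\<exists>x. dist (h x) y < r" ..
  qed
  moreover have "op_norm X norm norm (\<lambda>x. h x - f x) \<le> \<tau> 0"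
    unfolding op_norm_def
  proof (rule cSUP_least)
    show "X \<noteq> {}" using assms(4) E.subspace_0 by (auto simp: fin_dim_subspace_def)
    show "norm (h x - f x) / norm x \<le> \<tau> 0" if "x \<in> X" for x
      using hg[of x 0] that \<tau>_nonneg[of 0] by (cases "x = 0") (auto simp: 0 divide_le_eq)
  qed
  moreover have "\<tau> 0 < \<epsilon>" using \<eta> by (simp add: \<tau>_def \<theta>_def field_simps)
  ultimately show ?thesis using h by (intro exI[of _ h]) auto
qed

end
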